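(* The scheme of a finite affine space $\mathcal A$ is schurian if and only if $\mathcal A$ is Desarguesian.
   Context: A coherent configuration is a pair $(\Omega,S)$ with $\Omega$ finite and $S$ a partition of $\Omega\times\Omega$ such that the diagonal $1_\Omega$ is a union of elements of $S$, $S$ is closed under transposition, and for $r,s,t\in S$ the number $c_{rs}^t=|\{\beta:(\alpha,\beta)\in r,(\beta,\gamma)\in s\}|$ does not depend on $(\alpha,\gamma)\in t$; a scheme is one with $1_\Omega\in S$. A scheme is schurian if $S$ is the set of orbits of some permutation group $G\le\mathrm{Sym}(\Omega)$ acting componentwise on $\Omega\times\Omega$. A finite affine space is a finite affine geometry of dimension at least $2$ (points, lines, parallelism), i.e. either a finite affine plane or a finite affine space of dimension $\ge 3$; it is Desarguesian if it is isomorphic to the affine geometry $\mathrm{AG}(n,q)$ over $\mathrm{GF}(q)$ for some $n\ge2$ and prime power $q$. The scheme of a finite affine space with point set $\Omega$ is $(\Omega,S)$ where $S$ consists of $1_\Omega$ together with the classes of the equivalence relation on pairs of distinct points in which $(\alpha,\beta)$ and $(\alpha',\beta')$ are equivalent iff the lines $\alpha\beta$ and $\alpha'\beta'$ are equal or parallel. *)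

theory Defs
  imports "HOL-Algebra.Ring" "HOL-Combinatorics.Permutations"
begin

text \<open>Axioms of an affine space (of dimension at least 2) as a linear space with a
parallelism satisfying the parallel axiom and the triangle axiom
(Lenz / Buekenhout, cf. Beutelspacher--Rosenbaum).  Lines are represented by their
point sets, which is harmless in a linear space.\<close>

definition collinear_pts :: "'a set set \<Rightarrow> 'a \<Rightarrow> 'a \<Rightarrow> 'a \<Rightarrow> bool" where
  "collinear_pts L a b c \<longleftrightarrow> (\<exists>l\<in>L. a \<in> l \<and> b \<in> l \<and> c \<in> l)"

definition finite_affine_space ::
  "'a set \<Rightarrow> 'a set set \<Rightarrow> ('a set \<Rightarrow> 'a set \<Rightarrow> bool) \<Rightarrow> bool" where
  "finite_affine_space P L par \<longleftrightarrow>
     finite P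
   \<and> (\<forall>l\<in>L. l \<subseteq> P \<and> 2 \<le> card l)
   \<and> (\<forall>p\<in>P. \<forall>q\<in>P. p \<noteq> q \<longrightarrow> (\<exists>!l. l \<in> L \<and> p \<in> l \<and> q \<in> l))
   \<and> (\<forall>l m. par l m \<longrightarrow> l \<in> L \<and> m \<in> L)
   \<and> (\<forall>l\<in>L. par l l)
   \<and> (\<forall>l m. par l m \<longrightarrow> par m l)
   \<and> (\<forall>l m k. par l m \<longrightarrow> par m k \<longrightarrow> par l k)
   \<and> (\<forall>p\<in>P. \<forall>l\<in>L. \<exists>!m. m \<in> L \<and> p \<in> m \<and> par m l)
   \<and> (\<forall>a\<in>P. \<forall>b\<in>P. \<forall>c\<in>P. \<forall>a'\<in>P. \<forall>b'\<in>P.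
        \<forall>lab\<in>L. \<forall>la'b'\<in>L. \<forall>lac\<in>L. \<forall>lbc\<in>L. \<forall>m1\<in>L. \<forall>m2\<in>L.
        \<not> collinear_pts L a b c \<and> a' \<noteq> b' \<and>
        a \<in> lab \<and> b \<in> lab \<and> a' \<in> la'b' \<and> b' \<in> la'b' \<and> par lab la'b' \<and>
        a \<in> lac \<and> c \<in> lac \<and> b \<in> lbc \<and> c \<in> lbc \<and>
        a' \<in> m1 \<and> par m1 lac \<and> b' \<in> m2 \<and> par m2 lbc
        \<longrightarrow> m1 \<inter> m2 \<noteq> {})
   \<and> (\<exists>a\<in>P. \<exists>b\<in>P. \<exists>c\<in>P. a \<noteq> b \<and> a \<noteq> c \<and> b \<noteq> c \<and> \<not> collinear_pts L a b c)"

definition dir_rel :: "'a set \<Rightarrow> 'a set set \<Rightarrow> ('a set \<Rightarrow> 'a set \<Rightarrow> bool) \<Rightarrow> 'a set \<Rightarrow> ('a \<times> 'a) set" where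
  "dir_rel P L par l0 =
     {(x, y). x \<in> P \<and> y \<in> P \<and> x \<noteq> y \<and> (\<exists>l\<in>L. x \<in> l \<and> y \<in> l \<and> par l l0)}"

definition affine_scheme :: "'a set \<Rightarrow> 'a set set \<Rightarrow> ('a set \<Rightarrow> 'a set \<Rightarrow> bool) \<Rightarrow> ('a \<times> 'a) set set" where
  "affine_scheme P L par = insert (Id_on P) (dir_rel P L par ` L)"

definition perm_group_on :: "'a set \<Rightarrow> ('a \<Rightarrow> 'a) set \<Rightarrow> bool" where
  "perm_group_on \<Omega> G \<longleftrightarrow>
     id \<in> G \<and> (\<forall>g\<in>G. g permutes \<Omega>) \<and> (\<forall>g\<in>G. \<forall>h\<in>G. g \<circ> h \<in> G)
     \<and> (\<forall>g\<in>G. \<exists>h\<in>G. g \<circ> h = id)"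

definition pair_orbit :: "('a \<Rightarrow> 'a) set \<Rightarrow> 'a \<times> 'a \<Rightarrow> ('a \<times> 'a) set" where
  "pair_orbit G x = {(g (fst x), g (snd x)) | g. g \<in> G}"

definition schurian :: "'a set \<Rightarrow> ('a \<times> 'a) set set \<Rightarrow> bool" where
  "schurian \<Omega> S \<longleftrightarrow> (\<exists>G. perm_group_on \<Omega> G \<and> S = pair_orbit G ` (\<Omega> \<times> \<Omega>))"

text \<open>Vectors of \<open>F^n\<close> are functions \<open>nat \<Rightarrow> nat\<close> with coordinates below \<open>n\<close> in the
carrier and zero elsewhere.  Every finite field is isomorphic to one whose carrier is
a set of naturals, so fixing the element type \<open>nat\<close> loses no generality.\<close>

definition AG_points :: "nat \<Rightarrow> nat ring \<Rightarrow> (nat \<Rightarrow> nat) set" where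
  "AG_points n F = {v. (\<forall>i<n. v i \<in> carrier F) \<and> (\<forall>i\<ge>n. v i = \<zero>\<^bsub>F\<^esub>)}"

definition AG_lines :: "nat \<Rightarrow> nat ring \<Rightarrow> (nat \<Rightarrow> nat) set set" where
  "AG_lines n F = {{(\<lambda>i. a i \<oplus>\<^bsub>F\<^esub> (t \<otimes>\<^bsub>F\<^esub> d i)) | t. t \<in> carrier F} | a d.
      a \<in> AG_points n F \<and> d \<in> AG_points n F \<and> d \<noteq> (\<lambda>i. \<zero>\<^bsub>F\<^esub>)}"

definition AG_par :: "nat \<Rightarrow> nat ring \<Rightarrow> (nat \<Rightarrow> nat) set \<Rightarrow> (nat \<Rightarrow> nat) set \<Rightarrow> bool" where
  "AG_par n F l m \<longleftrightarrow> l \<in> AG_lines n F \<and> m \<in> AG_lines n F \<and>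
     (\<exists>v\<in>AG_points n F. m = (\<lambda>x i. x i \<oplus>\<^bsub>F\<^esub> v i) ` l)"

definition affine_iso ::
  "'a set \<Rightarrow> 'a set set \<Rightarrow> ('a set \<Rightarrow> 'a set \<Rightarrow> bool) \<Rightarrow>
   'b set \<Rightarrow> 'b set set \<Rightarrow> ('b set \<Rightarrow> 'b set \<Rightarrow> bool) \<Rightarrow> bool" where
  "affine_iso P L par P' L' par' \<longleftrightarrow>
     (\<exists>f. bij_betw f P P' \<and> (\<lambda>l. f ` l) ` L = L' \<and>
          (\<forall>l\<in>L. \<forall>m\<in>L. par l m \<longleftrightarrow> par' (f ` l) (f ` m)))"

definition desarguesian :: "'a set \<Rightarrow> 'a set set \<Rightarrow> ('a set \<Rightarrow> 'a set \<Rightarrow> bool) \<Rightarrow> bool" where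
  "desarguesian P L par \<longleftrightarrow>
     (\<exists>(F :: nat ring) n. field F \<and> finite (carrier F) \<and> 2 \<le> n \<and>
        affine_iso P L par (AG_points n F) (AG_lines n F) (AG_par n F))"

end

theory Submission
  imports
    "HOL-Computational_Algebra.Polynomial_Factorial"
    "HOL-Computational_Algebra.Fundamental_Theorem_Algebra"
    "HOL-Algebra.Group_Action"
    "HOL-Algebra.Subrings"
    "HOL-Algebra.Weak_Morphisms"
    "HOL-Algebra.Module"
    Defs
begin

text \<open>
  A group whose orbits on pairs are the classes of the affine scheme consists of dilatations, its point
  stabilizers are transitive on the remaining points of each line through the fixed point, and an
  element with two fixed points is trivial.  Hence the elements taking \<open>x\<close> to \<open>y\<close> are one more than the
  possible centres of homotheties among them, so that one of them is a translation.  The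
  translations form a regular abelian group, which turns the points into an abelian group.  Its
  endomorphisms preserving all lines through the origin form a finite division ring, which is a
  field by Wedderburn's little theorem, and the point stabilizer shows that every line through the
  origin is a one-dimensional subspace over this field.  A basis then gives the isomorphism with
  \<open>AG(n, q)\<close>.  Conversely, in \<open>AG(n, q)\<close> the maps \<open>x \<mapsto> c x + v\<close> with \<open>c \<noteq> 0\<close> act transitively on the
  pairs of each direction.
\<close>

section \<open>Wedderburn's little theorem\<close>

text \<open>Desargues' configuration never occurs: its role is taken over by the supply of
  dilatations in the group, so planes and higher dimensions need no separate treatment. The obstacle
  is that a schurian scheme only provides some transitive group of dilatations; that it contains
  translations at all, that these are closed under composition and that they commute must be
  extracted from fixed point arguments. Finiteness enters in three essential ways: the pigeonhole
  count that yields a translation, the surjectivity of injective scalars, and the commutativity of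
  the division ring. The geometry is reduced beforehand to one function \<open>dir\<close> on pairs
  of points that is only ever compared for equality; orbits of pairs of distinct points are then its
  level sets, and both implications become statements about \<open>dir\<close>.\<close>

lemma map_poly_of_int_mult:
  "map_poly (of_int :: int \<Rightarrow> complex) (p * q) = map_poly of_int p * map_poly of_int q"
  by (intro poly_eqI) (simp add: coeff_map_poly coeff_mult)

lemma poly_map_poly_of_int:
  "poly (map_poly (of_int :: int \<Rightarrow> complex) p) (of_int x) = of_int (poly p x)"
  by (induction p) (simp_all add: map_poly_pCons)

abbreviation xpow_minus_1 :: "nat \<Rightarrow> int poly" where
  "xpow_minus_1 n \<equiv> Polynomial.monom 1 n - 1"

lemma poly_map_xpow_minus_1:
  "poly (map_poly (of_int :: int \<Rightarrow> complex) (xpow_minus_1 n)) z = z ^ n - 1"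
proof -
  have "map_poly (of_int :: int \<Rightarrow> complex) (xpow_minus_1 n) = Polynomial.monom 1 n - 1"
    by (intro poly_eqI) (simp add: coeff_map_poly)
  then show ?thesis by (simp add: poly_monom)
qed

lemma xpow_minus_1_dvd:
  assumes "d dvd n" shows "xpow_minus_1 d dvd xpow_minus_1 n"
proof -
  obtain k where k: "n = d * k" using assms by blast
  have "Polynomial.monom (1::int) n = Polynomial.monom 1 d ^ k" by (simp add: monom_power k)
  moreover have "Polynomial.monom (1::int) d - 1 dvd Polynomial.monom 1 d ^ k - 1 ^ k"
    unfolding power_diff_sumr2 by (rule dvd_triv_left)
  ultimately show ?thesis by simp
qed

text \<open>A root of unity has modulus 1, and on the unit circle only 1 has real part at least 1.
  The real part alone then gives |q - z| >= q - Re z > q - 1.\<close>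

lemma dist_root_of_unity_gt:
  fixes z :: complex and q :: real
  assumes "z ^ n = 1" "0 < n" "z \<noteq> 1"
  shows "q - 1 < cmod (of_real q - z)"
proof (rule ccontr)
  assume "\<not> ?thesis"
  have "cmod z = 1"
    using assms(1,2) by (metis norm_one norm_power norm_ge_zero power_eq_1_iff zero_less_iff_neq_zero)
  have "q - Re z \<le> cmod (of_real q - z)"
    using complex_Re_le_cmod[of "of_real q - z"] by simp
  with \<open>\<not> ?thesis\<close> have "1 \<le> Re z" by simp
  with \<open>cmod z = 1\<close> have "Re z = 1" using complex_Re_le_cmod[of z] by simp
  moreover have "Im z = 0" using \<open>cmod z = 1\<close> \<open>Re z = 1\<close>
    by (simp add: cmod_def)
  ultimately have "z = 1" by (simp add: complex_eq_iff)
  with assms(3) show False by simp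
qed

text \<open>The divisor \<open>M\<close> is the value at \<open>q\<close> of the quotient of \<open>X^n - 1\<close> by the least common multiple of
  the \<open>X^d - 1\<close>; working with the least common multiple in \<open>\<int>[X]\<close> avoids proving that cyclotomic
  polynomials are integral.\<close>

lemma exists_large_primitive_divisor:
  fixes q n :: nat
  assumes q: "2 \<le> q" and n: "2 \<le> n"
  obtains M :: int where "int q - 1 < \<bar>M\<bar>"
    "\<And>d. \<lbrakk>d dvd n; d < n\<rbrakk> \<Longrightarrow> (int q ^ d - 1) * M dvd int q ^ n - 1"
proof -
  let ?C = "map_poly (of_int :: int \<Rightarrow> complex)"
  define D where "D = {d. d dvd n \<and> d < n}"
  have finD: "finite D" and posD: "\<And>d. d \<in> D \<Longrightarrow> 0 < d"
    using n by (auto simp: D_def intro: dvd_pos_nat)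
  define Lc where "Lc = Lcm (xpow_minus_1 ` D)"
  have "Lc dvd xpow_minus_1 n"
    unfolding Lc_def by (rule Lcm_least) (auto simp: D_def intro: xpow_minus_1_dvd)
  then obtain M where M: "xpow_minus_1 n = Lc * M" by blast
  have dvdM: "xpow_minus_1 d * M dvd xpow_minus_1 n" if "d \<in> D" for d
    unfolding M Lc_def using that by (intro mult_dvd_mono dvd_Lcm imageI) auto
  \<comment> \<open>A monic product over the integers forces both factors to have leading
    coefficient 1 or -1; this later removes the constant in front of the product over the roots of
    \<open>M\<close>.\<close>
  have lead: "lead_coeff (xpow_minus_1 n) = 1"
  proof -
    have "degree (xpow_minus_1 n) = n"
      using n degree_add_eq_left[of "- 1" "Polynomial.monom (1::int) n"] by (simp add: degree_monom_eq)
    then show ?thesis using n by simp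
  qed
  then have M0: "M \<noteq> 0" using M by auto
  have "lead_coeff Lc * lead_coeff M = 1"
    using lead unfolding M lead_coeff_mult .
  then have "\<bar>lead_coeff M * lead_coeff Lc\<bar> = 1"
    by (simp only: mult.commute abs_one)
  then have leadM: "\<bar>lead_coeff M\<bar> = 1" by (rule abs_zmult_eq_1)
  \<comment> \<open>A primitive \<open>n\<close>-th root of unity is a root of no X^d - 1 with d in
    \<open>D\<close>, hence not of \<open>Lc\<close>, hence of \<open>M\<close>. So \<open>M\<close>
    has a root, which supplies the one strict factor in the final estimate.\<close>
  define \<omega> where "\<omega> = cis (2 * pi / n)"
  have \<omega>n: "\<omega> ^ n = 1" using n by (simp add: \<omega>_def DeMoivre)
  have \<omega>d: "\<omega> ^ d \<noteq> 1" if "0 < d" "d < n" for d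
  proof
    assume "\<omega> ^ d = 1"
    have inj: "inj_on (\<lambda>k. cis (2 * pi * real k / real n)) {..<n}"
      using n bij_betw_roots_unity[of n] by (auto simp: bij_betw_def)
    have "cis (2 * pi * real d / real n) = cis (2 * pi * real 0 / real n)"
      using \<open>\<omega> ^ d = 1\<close> by (simp add: \<omega>_def DeMoivre field_simps)
    from inj_onD[OF inj this] that n show False by simp
  qed
  have "Lc dvd (\<Prod>d\<in>D. xpow_minus_1 d)"
    unfolding Lc_def by (rule Lcm_least) (auto intro: dvd_prodI finD)
  then obtain S where S: "(\<Prod>d\<in>D. xpow_minus_1 d) = Lc * S" by blast
  have "poly (?C Lc) \<omega> \<noteq> 0"
  proof
    assume "poly (?C Lc) \<omega> = 0"
    then have "poly (?C (\<Prod>d\<in>D. xpow_minus_1 d)) \<omega> = 0"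
      by (simp add: S map_poly_of_int_mult)
    moreover have "poly (?C (\<Prod>d\<in>A. xpow_minus_1 d)) \<omega> = (\<Prod>d\<in>A. \<omega> ^ d - 1)" if "finite A" for A
      using that by (induction A) (simp_all add: map_poly_of_int_mult poly_map_xpow_minus_1)
    ultimately obtain d where "d \<in> D" "\<omega> ^ d = 1"
      using finD by (auto simp: prod_zero_iff)
    with \<omega>d[of d] posD[of d] show False by (auto simp: D_def)
  qed
  moreover have eval: "z ^ n - 1 = poly (?C Lc) z * poly (?C M) z" for z
    using poly_map_xpow_minus_1[of n z] unfolding M map_poly_of_int_mult by simp
  ultimately have root: "poly (?C M) \<omega> = 0" using \<omega>n by (metis diff_self mult_eq_0_iff)
  \<comment> \<open>The distance estimate excludes the root of unity 1. Since 1 is in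
    \<open>D\<close>, \<open>M\<close> divides 1 + X + ... + X^(n-1), whose value at 1 is
    \<open>n\<close>.\<close>
  have not1: "poly M 1 \<noteq> 0"
  proof -
    have "xpow_minus_1 1 * M dvd xpow_minus_1 n" using n by (intro dvdM) (simp add: D_def)
    moreover have "xpow_minus_1 n = xpow_minus_1 1 * (\<Sum>i<n. Polynomial.monom 1 i)"
      using one_diff_power_eq[of "Polynomial.monom (1::int) 1" n]
      by (simp add: monom_power algebra_simps)
    moreover have "xpow_minus_1 1 \<noteq> 0" by (simp add: poly_eq_iff) (metis coeff_1 Polynomial.coeff_monom one_neq_zero zero_neq_one)
    ultimately have "M dvd (\<Sum>i<n. Polynomial.monom 1 i)" by simp
    moreover have "poly (\<Sum>i<n. Polynomial.monom (1::int) i) 1 = n" by (simp add: poly_sum poly_monom)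
    ultimately show ?thesis using n by (auto simp: dvd_def)
  qed
  define Z where "Z = {z. poly (?C M) z = 0}"
  have CM0: "?C M \<noteq> 0" using M0 by (simp add: map_poly_eq_0_iff)
  have finZ: "finite Z" unfolding Z_def using CM0 by (rule poly_roots_finite)
  have gt: "real q - 1 < cmod (of_nat q - z)" if "z \<in> Z" for z
  proof -
    have "z ^ n = 1" using eval[of z] that by (simp add: Z_def)
    moreover have "z \<noteq> 1" using that not1 poly_map_poly_of_int[of M 1] by (auto simp: Z_def)
    ultimately show ?thesis using dist_root_of_unity_gt[of z n "real q"] n by simp
  qed
  have ordpos: "0 < Polynomial.order z (?C M)" if "z \<in> Z" for z
    using that CM0 by (simp add: Z_def order_root)
  have "\<omega> \<in> Z" using root by (simp add: Z_def)
  have "?C M = Polynomial.smult (lead_coeff (?C M)) (\<Prod>z\<in>Z. [:-z, 1:] ^ Polynomial.order z (?C M))"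
    unfolding Z_def by (rule complex_poly_decompose[symmetric])
  then have "poly (?C M) (of_nat q) =
      lead_coeff (?C M) * (\<Prod>z\<in>Z. (of_nat q - z) ^ Polynomial.order z (?C M))"
    by (metis (no_types, lifting) poly_smult poly_prod poly_power prod.cong poly_pCons poly_0 mult_zero_right add_0_right mult_1_right uminus_add_conv_diff add_0)
  then have "cmod (poly (?C M) (of_nat q)) =
      cmod (lead_coeff (?C M)) * (\<Prod>z\<in>Z. cmod (of_nat q - z) ^ Polynomial.order z (?C M))"
    by (simp add: norm_mult norm_power prod_norm[symmetric])
  moreover have "cmod (lead_coeff (?C M)) = 1"
    using leadM M0 by (simp add: degree_map_poly coeff_map_poly)
  ultimately have "cmod (poly (?C M) (of_nat q)) =
      (\<Prod>z\<in>Z. cmod (of_nat q - z) ^ Polynomial.order z (?C M))" by simp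
  also have "\<dots> = cmod (of_nat q - \<omega>) ^ Polynomial.order \<omega> (?C M) *
      (\<Prod>z\<in>Z-{\<omega>}. cmod (of_nat q - z) ^ Polynomial.order z (?C M))"
    by (rule prod.remove[OF finZ \<open>\<omega> \<in> Z\<close>])
  \<comment> \<open>Each factor exceeds q - 1 >= 1, so the factors at other roots are bounded below
    by 1, and the positive multiplicity of \<open>\<omega>\<close> may be lowered to 1.\<close>
  also have "\<dots> \<ge> cmod (of_nat q - \<omega>) * 1"
  proof (intro mult_mono prod_ge_1 one_le_power)
    have ge1: "1 \<le> cmod (of_nat q - z)" if "z \<in> Z" for z
      using gt[OF that] q by linarith
    show "cmod (of_nat q - \<omega>) \<le> cmod (of_nat q - \<omega>) ^ Polynomial.order \<omega> (?C M)"
      using ge1[OF \<open>\<omega> \<in> Z\<close>] ordpos[OF \<open>\<omega> \<in> Z\<close>] by (simp add: self_le_power)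
    show "1 \<le> cmod (of_nat q - z)" if "z \<in> Z - {\<omega>}" for z using ge1 that by simp
  qed auto
  finally have "real q - 1 < cmod (poly (?C M) (of_nat q))"
    using gt[OF \<open>\<omega> \<in> Z\<close>] by simp
  also have "poly (?C M) (of_nat q) = of_int (poly M (int q))"
    using poly_map_poly_of_int[of M "int q"] by simp
  finally have "int q - 1 < \<bar>poly M (int q)\<bar>"
    by (simp add: norm_of_int)
  moreover have "(int q ^ d - 1) * poly M (int q) dvd int q ^ n - 1" if "d dvd n" "d < n" for d
  proof -
    have "xpow_minus_1 d * M dvd xpow_minus_1 n" using that by (intro dvdM) (simp add: D_def)
    then obtain U where "xpow_minus_1 n = xpow_minus_1 d * M * U" by blast
    then have "poly (xpow_minus_1 n) (int q) = poly (xpow_minus_1 d * M * U) (int q)" by simp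
    then show ?thesis by (simp add: poly_monom dvd_def)
  qed
  ultimately show thesis by (rule that)
qed

text \<open>Euclid's algorithm on exponents: removing q^(n-d) copies of q^d - 1 from q^n - 1 leaves
  q^(n-d) - 1. Once the exponent is below \<open>d\<close>, the divisor is too large unless the
  remainder is 0.\<close>

lemma power_minus_1_dvd_imp_dvd:
  fixes q d n :: nat
  assumes "2 \<le> q" "0 < d" "q ^ d - 1 dvd q ^ n - 1"
  shows "d dvd n"
  using assms(3)
proof (induction n rule: less_induct)
  case (less n)
  show ?case
  proof (cases "n < d")
    case True
    then have "q ^ n - 1 < q ^ d - 1" using assms(1,2)
      by (meson diff_less_mono one_le_power order.strict_trans1 power_strict_increasing_iff le_refl less_le_trans one_less_numeral_iff semiring_norm(76) Suc_1 lessI order_trans one_le_numeral)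
    with less.prems have "q ^ n - 1 = 0" using nat_dvd_not_less by auto
    then have "n = 0" using assms(1) by (cases n) (auto simp: le_Suc_eq)
    then show ?thesis by simp
  next
    case False
    then have "q ^ n - 1 = q ^ (n - d) * (q ^ d - 1) + (q ^ (n - d) - 1)"
      using assms(1) by (simp add: diff_mult_distrib2 power_add[symmetric])
    then have "q ^ d - 1 dvd q ^ (n - d) - 1"
      using less.prems by (simp add: dvd_add_right_iff)
    then have "d dvd n - d" using less.IH[of "n - d"] False assms(2) by simp
    then show ?thesis using False by (simp add: dvd_diff_nat dvd_minus_self)
  qed
qed

section \<open>Coordinate vectors and bases of finite modules\<close>

text \<open>The encoding of \<open>AG_points\<close>, but over an arbitrary element type: it also
  serves for centralizers over the centre of a division ring.\<close>

definition coords :: "nat \<Rightarrow> ('a, 'm) ring_scheme \<Rightarrow> (nat \<Rightarrow> 'a) set" where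
  "coords n R = {v. (\<forall>i<n. v i \<in> carrier R) \<and> (\<forall>i\<ge>n. v i = \<zero>\<^bsub>R\<^esub>)}"

lemma finite_card_coords:
  assumes "finite (carrier R)"
  shows "finite (coords n R)" "card (coords n R) = card (carrier R) ^ n"
proof -
  let ?ext = "\<lambda>v i. if i < n then v i else \<zero>\<^bsub>R\<^esub>"
  have bij: "bij_betw ?ext (PiE {..<n} (\<lambda>_. carrier R)) (coords n R)"
  proof (rule bij_betw_byWitness[where f' = "\<lambda>v. restrict v {..<n}"])
    show "\<forall>v\<in>PiE {..<n} (\<lambda>_. carrier R). restrict (?ext v) {..<n} = v"
      by (auto simp: PiE_def extensional_def fun_eq_iff)
    show "\<forall>v\<in>coords n R. ?ext (restrict v {..<n}) = v"
      by (auto simp: coords_def fun_eq_iff)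
    show "?ext ` PiE {..<n} (\<lambda>_. carrier R) \<subseteq> coords n R"
      by (rule image_subsetI) (simp add: coords_def PiE_iff)
    show "(\<lambda>v. restrict v {..<n}) ` coords n R \<subseteq> PiE {..<n} (\<lambda>_. carrier R)"
      by (rule image_subsetI) (simp add: coords_def PiE_iff)
  qed
  have fin: "finite (PiE {..<n} (\<lambda>_. carrier R))" using assms by (simp add: finite_PiE)
  have card: "card (PiE {..<n} (\<lambda>_. carrier R)) = card (carrier R) ^ n"
    by (simp add: card_PiE)
  show "finite (coords n R)" using bij_betw_finite[OF bij] fin by simp
  show "card (coords n R) = card (carrier R) ^ n" using bij_betw_same_card[OF bij] card by simp
qed

text \<open>Recursion on the length makes the appending of one vector to a family, the step in
  \<open>exists_basis\<close>, a single unfolding.\<close>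

primrec lincomb :: "('a, 'b, 'm) module_scheme \<Rightarrow> (nat \<Rightarrow> 'b) \<Rightarrow> nat \<Rightarrow> (nat \<Rightarrow> 'a) \<Rightarrow> 'b" where
  "lincomb M b 0 v = \<zero>\<^bsub>M\<^esub>"
| "lincomb M b (Suc k) v = lincomb M b k v \<oplus>\<^bsub>M\<^esub> v k \<odot>\<^bsub>M\<^esub> b k"

lemma lincomb_cong:
  "\<lbrakk>\<And>i. i < k \<Longrightarrow> u i = v i; \<And>i. i < k \<Longrightarrow> b i = c i\<rbrakk> \<Longrightarrow> lincomb M b k u = lincomb M c k v"
  by (induction k) auto

lemma (in module) lincomb_closed:
  "\<lbrakk>\<And>i. b i \<in> carrier M; \<And>i. i < k \<Longrightarrow> v i \<in> carrier R\<rbrakk> \<Longrightarrow> lincomb M b k v \<in> carrier M"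
  by (induction k) auto

lemma (in module) lincomb_add:
  assumes "\<And>i. b i \<in> carrier M"
  shows "\<lbrakk>\<And>i. i < k \<Longrightarrow> u i \<in> carrier R; \<And>i. i < k \<Longrightarrow> v i \<in> carrier R\<rbrakk> \<Longrightarrow>
    lincomb M b k (\<lambda>i. u i \<oplus> v i) = lincomb M b k u \<oplus>\<^bsub>M\<^esub> lincomb M b k v"
proof (induction k)
  case (Suc k)
  have "lincomb M b k u \<in> carrier M" "lincomb M b k v \<in> carrier M"
    using Suc.prems assms by (auto intro!: lincomb_closed)
  moreover have "u k \<odot>\<^bsub>M\<^esub> b k \<in> carrier M" "v k \<odot>\<^bsub>M\<^esub> b k \<in> carrier M"
    using Suc.prems assms by auto
  ultimately show ?case using Suc assms by (simp add: smult_l_distr M.a_ac)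
qed simp

lemma (in module) lincomb_smult:
  assumes "\<And>i. b i \<in> carrier M" "c \<in> carrier R"
  shows "(\<And>i. i < k \<Longrightarrow> v i \<in> carrier R) \<Longrightarrow>
    lincomb M b k (\<lambda>i. c \<otimes> v i) = c \<odot>\<^bsub>M\<^esub> lincomb M b k v"
proof (induction k)
  case (Suc k)
  have "lincomb M b k v \<in> carrier M" using Suc.prems assms by (auto intro!: lincomb_closed)
  then show ?case using Suc assms by (simp add: smult_r_distr smult_assoc1)
qed (use assms in simp)

text \<open>Linear independence is expressed as injectivity of the coordinate map. Lengths of
  independent families are bounded because 2^n <= |R|^n <= |M|, and a family of maximal length
  spans: a vector outside its span could be appended.\<close>

lemma (in module) exists_basis:
  assumes "field R" and finR: "finite (carrier R)" and finM: "finite (carrier M)"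
  obtains n b where "\<And>i. b i \<in> carrier M" "bij_betw (lincomb M b n) (coords n R) (carrier M)"
proof -
  interpret F: field R by fact
  define S where "S = {n. \<exists>b. (\<forall>i. b i \<in> carrier M) \<and> inj_on (lincomb M b n) (coords n R)}"
  have closed: "lincomb M b n v \<in> carrier M" if "\<forall>i. b i \<in> carrier M" "v \<in> coords n R" for b n v
    using that by (intro lincomb_closed) (auto simp: coords_def)
  have "n \<le> card (carrier M)" if n: "n \<in> S" for n
  proof -
    obtain b where b: "\<forall>i. b i \<in> carrier M" "inj_on (lincomb M b n) (coords n R)"
      using n by (auto simp: S_def)
    have "card {\<zero>, \<one>} \<le> card (carrier R)" by (intro card_mono finR) auto
    then have two: "2 \<le> card (carrier R)" by simp
    have "n < 2 ^ n" by simp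
    also have "\<dots> \<le> card (carrier R) ^ n" using two by (simp add: power_mono)
    also have "\<dots> = card (lincomb M b n ` coords n R)"
      using b finite_card_coords[OF finR] by (simp add: card_image)
    also have "\<dots> \<le> card (carrier M)" using closed b by (intro card_mono finM) auto
    finally show ?thesis by simp
  qed
  then have finS: "finite S" by (meson finite_nat_set_iff_bounded_le)
  have "coords 0 R = {\<lambda>_. \<zero>}" by (auto simp: coords_def)
  then have "0 \<in> S" by (auto simp: S_def intro!: exI[of _ "\<lambda>_. \<zero>\<^bsub>M\<^esub>"])
  define n where "n = Max S"
  have "n \<in> S" unfolding n_def using finS \<open>0 \<in> S\<close> by (intro Max_in) auto
  then obtain b where b: "\<And>i. b i \<in> carrier M" and inj: "inj_on (lincomb M b n) (coords n R)"
    by (auto simp: S_def)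
  have "carrier M \<subseteq> lincomb M b n ` coords n R"
  proof (rule ccontr)
    assume "\<not> ?thesis"
    then obtain x where x: "x \<in> carrier M" "x \<notin> lincomb M b n ` coords n R" by blast
    let ?c = "b(n := x)"
    have "inj_on (lincomb M ?c (Suc n)) (coords (Suc n) R)"
    proof (rule inj_onI)
      fix u v assume u: "u \<in> coords (Suc n) R" and v: "v \<in> coords (Suc n) R"
        and "lincomb M ?c (Suc n) u = lincomb M ?c (Suc n) v"
      let ?cut = "\<lambda>w i. if i < n then w i else \<zero>"
      have uc: "u i \<in> carrier R" and vc: "v i \<in> carrier R" for i
        using u v by (cases "i < Suc n"; force simp: coords_def)+
      have cutc: "?cut u \<in> coords n R" "?cut v \<in> coords n R"
        using uc vc by (auto simp: coords_def)
      have lu: "lincomb M ?c n u = lincomb M b n (?cut u)" and lv: "lincomb M ?c n v = lincomb M b n (?cut v)"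
        by (auto intro: lincomb_cong)
      let ?U = "lincomb M b n (?cut u)" and ?V = "lincomb M b n (?cut v)"
      have UV: "?U \<in> carrier M" "?V \<in> carrier M" using closed b cutc by auto
      have eq: "?U \<oplus>\<^bsub>M\<^esub> u n \<odot>\<^bsub>M\<^esub> x = ?V \<oplus>\<^bsub>M\<^esub> v n \<odot>\<^bsub>M\<^esub> x"
        using \<open>lincomb M ?c (Suc n) u = _\<close> lu lv by simp
      \<comment> \<open>Unequal coefficients of \<open>x\<close> would have an invertible difference
        \<open>d\<close>, and dividing by it would put \<open>x\<close> into the span of
        \<open>b\<close>.\<close>
      have un: "u n = v n"
      proof (rule ccontr)
        assume "u n \<noteq> v n"
        define d where "d = u n \<ominus> v n"
        have d: "d \<in> carrier R" "d \<noteq> \<zero>" using \<open>u n \<noteq> v n\<close> uc vc by (auto simp: d_def)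
        then have dU: "d \<in> Units R" by (simp add: F.field_Units)
        have "?V \<oplus>\<^bsub>M\<^esub> \<ominus>\<^bsub>M\<^esub> ?U = d \<odot>\<^bsub>M\<^esub> x"
        proof -
          have "u n \<odot>\<^bsub>M\<^esub> x = \<ominus>\<^bsub>M\<^esub> ?U \<oplus>\<^bsub>M\<^esub> (?U \<oplus>\<^bsub>M\<^esub> u n \<odot>\<^bsub>M\<^esub> x)"
            using UV uc x by (simp add: M.r_neg1)
          also have "\<dots> = (?V \<oplus>\<^bsub>M\<^esub> \<ominus>\<^bsub>M\<^esub> ?U) \<oplus>\<^bsub>M\<^esub> v n \<odot>\<^bsub>M\<^esub> x"
            unfolding eq using UV vc x by (simp add: M.a_ac)
          finally have "u n \<odot>\<^bsub>M\<^esub> x = (?V \<oplus>\<^bsub>M\<^esub> \<ominus>\<^bsub>M\<^esub> ?U) \<oplus>\<^bsub>M\<^esub> v n \<odot>\<^bsub>M\<^esub> x" .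
          moreover have "u n \<odot>\<^bsub>M\<^esub> x = d \<odot>\<^bsub>M\<^esub> x \<oplus>\<^bsub>M\<^esub> v n \<odot>\<^bsub>M\<^esub> x"
          proof -
            have "u n = d \<oplus> v n" using uc vc unfolding d_def by (simp add: R.minus_eq R.a_assoc R.l_neg)
            then show ?thesis using d vc x by (simp add: smult_l_distr)
          qed
          ultimately have "(?V \<oplus>\<^bsub>M\<^esub> \<ominus>\<^bsub>M\<^esub> ?U) \<oplus>\<^bsub>M\<^esub> v n \<odot>\<^bsub>M\<^esub> x = d \<odot>\<^bsub>M\<^esub> x \<oplus>\<^bsub>M\<^esub> v n \<odot>\<^bsub>M\<^esub> x"
            by (rule trans[OF sym])
          then show ?thesis
            by (rule M.add.right_cancel[THEN iffD1, rotated -1]) (use UV vc x d in auto)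
        qed
        then have xe: "x = inv d \<odot>\<^bsub>M\<^esub> (?V \<oplus>\<^bsub>M\<^esub> \<ominus>\<^bsub>M\<^esub> ?U)"
          using x d dU by (simp add: smult_assoc1[symmetric] R.Units_l_inv R.Units_inv_closed)
        \<comment> \<open>The coordinates of (V - U) / d. The difference is written with a
          multiplication by -1, so that additivity and homogeneity of \<open>lincomb\<close>
          suffice.\<close>
        define w where "w = (\<lambda>i. inv d \<otimes> (?cut v i \<oplus> (\<ominus> \<one>) \<otimes> ?cut u i))"
        have wc: "w \<in> coords n R" using uc vc dU by (auto simp: w_def coords_def R.Units_inv_closed)
        have "lincomb M b n w = inv d \<odot>\<^bsub>M\<^esub> lincomb M b n (\<lambda>i. ?cut v i \<oplus> (\<ominus> \<one>) \<otimes> ?cut u i)"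
          unfolding w_def using uc vc dU b by (intro lincomb_smult) (auto simp: R.Units_inv_closed)
        also have "lincomb M b n (\<lambda>i. ?cut v i \<oplus> (\<ominus> \<one>) \<otimes> ?cut u i)
            = ?V \<oplus>\<^bsub>M\<^esub> lincomb M b n (\<lambda>i. (\<ominus> \<one>) \<otimes> ?cut u i)"
          using uc vc b by (intro lincomb_add) auto
        also have "lincomb M b n (\<lambda>i. (\<ominus> \<one>) \<otimes> ?cut u i) = (\<ominus> \<one>) \<odot>\<^bsub>M\<^esub> ?U"
          using uc vc b by (intro lincomb_smult) auto
        also have "(\<ominus> \<one>) \<odot>\<^bsub>M\<^esub> ?U = \<ominus>\<^bsub>M\<^esub> ?U" using UV by (simp add: smult_l_minus)
        finally have "x = lincomb M b n w" using xe by simp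
        with x wc show False by blast
      qed
      have "?U = ?V" using eq UV uc vc x unfolding un by (simp add: M.add.right_cancel)
      with inj_onD[OF inj _ cutc] have cut: "?cut u = ?cut v" by blast
      show "u = v"
      proof
        fix i
        show "u i = v i"
          using fun_cong[OF cut, of i] un u v by (cases "i < n"; cases "i = n") (auto simp: coords_def)
      qed
    qed
    moreover have "\<forall>i. ?c i \<in> carrier M" using b x by simp
    ultimately have "Suc n \<in> S" unfolding S_def by blast
    then have "Suc n \<le> n" unfolding n_def using finS by (rule Max_ge[rotated])
    then show False by simp
  qed
  then have "bij_betw (lincomb M b n) (coords n R) (carrier M)"
    using inj closed b by (auto simp: bij_betw_def)
  with b show thesis by (rule that)
qed

text \<open>Witt's argument with the class equation. Let \<open>q\<close> be the size of the centre
  and q^n that of the ring. A non-central element has a centralizer of size q^d with d a proper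
  divisor of n, so its conjugacy class has (q^n - 1)/(q^d - 1) elements, a multiple of
  \<open>M\<close>. The classes fill the q^n - q non-central elements; hence \<open>M\<close>
  divides q^n - q and q^n - 1, thus q - 1, which is too small.\<close>

theorem (in ring) wedderburn_little:
  assumes fin: "finite (carrier R)" and units: "Units R = carrier R - {\<zero>}"
    and "a \<in> carrier R" "b \<in> carrier R"
  shows "a \<otimes> b = b \<otimes> a"
proof -
  define C where "C a = {x \<in> carrier R. x \<otimes> a = a \<otimes> x}" for a
  define Z where "Z = {z \<in> carrier R. \<forall>x\<in>carrier R. z \<otimes> x = x \<otimes> z}"
  let ?K = "R\<lparr>carrier := Z\<rparr>"
  have C_sub: "subring (C a) R" if "a \<in> carrier R" for a
  proof (rule subringI)
    show "\<ominus> h \<in> C a" if "h \<in> C a" for h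
      using that \<open>a \<in> carrier R\<close> by (simp add: C_def l_minus r_minus)
    show "h \<otimes> k \<in> C a" if "h \<in> C a" "k \<in> C a" for h k
    proof -
      have hk: "h \<in> carrier R" "k \<in> carrier R" "h \<otimes> a = a \<otimes> h" "k \<otimes> a = a \<otimes> k"
        using that by (auto simp: C_def)
      have "h \<otimes> k \<otimes> a = h \<otimes> (a \<otimes> k)" using hk \<open>a \<in> carrier R\<close> by (simp add: m_assoc)
      also have "\<dots> = (a \<otimes> h) \<otimes> k" using hk(1,2) \<open>a \<in> carrier R\<close> unfolding hk(3)[symmetric] by (simp add: m_assoc)
      finally show ?thesis using hk(1,2) \<open>a \<in> carrier R\<close> by (simp add: C_def m_assoc)
    qed
    show "h \<oplus> k \<in> C a" if "h \<in> C a" "k \<in> C a" for h k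
      using that \<open>a \<in> carrier R\<close> by (simp add: C_def l_distr r_distr)
  qed (use that in \<open>auto simp: C_def\<close>)
  have Z_C: "Z = (\<Inter>a\<in>carrier R. C a)" unfolding Z_def C_def using one_closed by auto
  have Z_sub: "subring Z R"
  proof (rule subringI)
    show "\<ominus> h \<in> Z" if "h \<in> Z" for h using that subringE(5)[OF C_sub] by (simp add: Z_C)
    show "h \<otimes> k \<in> Z" if "h \<in> Z" "k \<in> Z" for h k using that subringE(6)[OF C_sub] by (simp add: Z_C)
    show "h \<oplus> k \<in> Z" if "h \<in> Z" "k \<in> Z" for h k using that subringE(7)[OF C_sub] by (simp add: Z_C)
  qed (auto simp: Z_def)
  have ZR: "Z \<subseteq> carrier R" and Zcomm: "\<And>z x. \<lbrakk>z \<in> Z; x \<in> carrier R\<rbrakk> \<Longrightarrow> z \<otimes> x = x \<otimes> z"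
    unfolding Z_def by blast+
  have "subfield Z R"
  proof (rule subfieldI)
    show "subcring Z R" using Z_sub by (rule subcringI) (use ZR Zcomm in blast)
    show "Units ?K = Z - {\<zero>}"
    proof (intro equalityI subsetI)
      fix z assume "z \<in> Units ?K"
      then have "z \<in> Units R" "z \<in> Z" using ZR unfolding Units_def by auto
      then show "z \<in> Z - {\<zero>}" using units by auto
    next
      fix z assume z: "z \<in> Z - {\<zero>}"
      then have zU: "z \<in> Units R" using units ZR by blast
      have "inv z \<in> Z" unfolding Z_def
      proof (intro CollectI conjI ballI)
        show "inv z \<in> carrier R" using zU by (rule Units_inv_closed)
        fix x assume x: "x \<in> carrier R"
        have "inv z \<otimes> x = inv z \<otimes> (x \<otimes> z) \<otimes> inv z"
          using x zU by (simp add: m_assoc Units_r_inv Units_closed Units_inv_closed)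
        also have "x \<otimes> z = z \<otimes> x" using z x Zcomm[of z x] by simp
        also have "inv z \<otimes> (z \<otimes> x) \<otimes> inv z = x \<otimes> inv z"
          using x zU by (simp add: m_assoc[symmetric] Units_l_inv Units_closed Units_inv_closed)
        finally show "inv z \<otimes> x = x \<otimes> inv z" .
      qed
      with z zU show "z \<in> Units ?K"
        by (auto simp: Units_def[of ?K] intro!: bexI[of _ "inv z"] simp: Units_l_inv Units_r_inv)
    qed
  qed
  then have Z_field: "field ?K" by (rule subfield_iff(2))
  interpret K: field ?K by fact
  define q where "q = card Z"
  have finZ: "finite Z" using fin ZR by (rule finite_subset[rotated])
  have "card {\<zero>, \<one>} \<le> q" unfolding q_def
    using K.zero_closed K.one_closed by (intro card_mono finZ) auto
  moreover have one_zero: "\<one> \<noteq> \<zero>" using K.one_not_zero by simp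
  ultimately have q2: "2 \<le> q" by simp
  \<comment> \<open>Each centralizer is a vector space over the centre by multiplication, so a basis
    gives its size; \<open>a = \<one>\<close> gives the ring itself.\<close>
  have card_C: "\<exists>d. card (C a) = q ^ d" if a: "a \<in> carrier R" for a
  proof -
    note sub = subringE[OF C_sub[OF a]]
    define M where "M = \<lparr>carrier = C a, mult = (\<otimes>), one = \<one>, zero = \<zero>, add = (\<oplus>), smult = (\<otimes>)\<rparr>"
    have ZC: "Z \<subseteq> C a" using a Z_C by auto
    have Cc: "C a \<subseteq> carrier R" by (auto simp: C_def)
    have "module ?K M"
    proof (rule moduleI)
      show "cring ?K" ..
      show "abelian_group M"
      proof (rule abelian_groupI)
        show "\<exists>y\<in>carrier M. y \<oplus>\<^bsub>M\<^esub> x = \<zero>\<^bsub>M\<^esub>" if "x \<in> carrier M" for x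
          using that sub Cc by (auto simp: M_def intro!: bexI[of _ "\<ominus> x"] l_neg)
      qed (use sub Cc in \<open>auto simp: M_def a_ac subset_eq\<close>)
    qed (use sub Cc ZC in \<open>auto simp: M_def subset_eq l_distr r_distr m_assoc\<close>)
    then interpret M: module ?K M .
    have "finite (carrier ?K)" "finite (carrier M)"
      using finZ finite_subset[OF Cc fin] by (auto simp: M_def)
    then obtain n b where "bij_betw (lincomb M b n) (coords n ?K) (carrier M)"
      using M.exists_basis[OF Z_field] by blast
    then have "card (C a) = card (coords n ?K)" by (simp add: bij_betw_same_card M_def)
    then show ?thesis using finite_card_coords(2)[of ?K n] finZ by (auto simp: q_def)
  qed
  have "C \<one> = carrier R" by (auto simp: C_def)
  then obtain n where n: "card (carrier R) = q ^ n" using card_C[of \<one>] by auto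
  have "Z = carrier R"
  proof (rule ccontr)
    assume "Z \<noteq> carrier R"
    with ZR have "q < q ^ n" unfolding q_def n[symmetric, unfolded q_def]
      by (metis psubset_card_mono fin psubsetI)
    then have "n \<noteq> 0" "n \<noteq> 1" using q2 by (auto intro: ccontr)
    then have n2: "2 \<le> n" by simp
    obtain M :: int where M: "int q - 1 < \<bar>M\<bar>"
      "\<And>d. \<lbrakk>d dvd n; d < n\<rbrakk> \<Longrightarrow> (int q ^ d - 1) * M dvd int q ^ n - 1"
      using exists_large_primitive_divisor[OF q2 n2] by blast
    let ?G = "units_of R"
    interpret G: group ?G by (rule units_group)
    define \<phi> where "\<phi> = (\<lambda>g. \<lambda>h\<in>carrier ?G. g \<otimes>\<^bsub>?G\<^esub> h \<otimes>\<^bsub>?G\<^esub> inv\<^bsub>?G\<^esub> g)"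
    interpret A: group_action ?G "carrier ?G" \<phi> unfolding \<phi>_def by (rule G.action_by_conjugation)
    have carG: "carrier ?G = carrier R - {\<zero>}" by (simp add: units_of_carrier units)
    have \<phi>: "\<phi> g h = g \<otimes> h \<otimes> inv g" if "g \<in> Units R" "h \<in> Units R" for g h
      using that by (simp add: \<phi>_def units_of_carrier units_of_mult units_of_inv)
    have cent: "\<phi> g h = h \<longleftrightarrow> g \<otimes> h = h \<otimes> g" if "g \<in> Units R" "h \<in> Units R" for g h
      using that unfolding \<phi>[OF that]
      by (metis Units_closed Units_inv_closed Units_l_inv Units_r_inv m_assoc m_closed r_one)
    have ordG: "Coset.order ?G = q ^ n - 1"
      using fin n by (simp add: Coset.order_def carG)
    define NC where "NC = carrier R - Z"
    have NC_units: "NC \<subseteq> carrier ?G"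
      using K.zero_closed by (auto simp: NC_def carG)
    have dvd_orbit: "nat \<bar>M\<bar> dvd card (orbit ?G \<phi> a)" if a: "a \<in> NC" for a
    proof -
      have aU: "a \<in> Units R" and ac: "a \<in> carrier R" using a NC_units by (auto simp: units_of_carrier NC_def)
      have "stabilizer ?G \<phi> a = C a - {\<zero>}"
        using aU by (auto simp: stabilizer_def C_def carG cent units)
      moreover have "\<zero> \<in> C a" using subringE(2)[OF C_sub[OF ac]] .
      moreover obtain d where d: "card (C a) = q ^ d" using card_C[OF ac] by blast
      moreover have finC: "finite (C a)" using fin by (auto simp: C_def intro: finite_subset)
      ultimately have "card (stabilizer ?G \<phi> a) = q ^ d - 1" by (simp add: card_Diff_singleton)
      then have os: "card (orbit ?G \<phi> a) * (q ^ d - 1) = q ^ n - 1"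
        using A.orbit_stabilizer_theorem[of a] aU ordG by (simp add: units_of_carrier)
      have qn: "q ^ n - 1 \<noteq> 0" using \<open>q < q ^ n\<close> q2 by simp
      have "d \<noteq> 0" using os qn by (cases d) auto
      then have "d dvd n" using power_minus_1_dvd_imp_dvd[OF q2, of d n] os by (metis dvd_triv_right gr0I)
      moreover have "d \<noteq> n"
      proof
        assume "d = n"
        then have "C a = carrier R" using d n fin by (intro card_subset_eq) (auto simp: C_def)
        then have "x \<in> C a" if "x \<in> carrier R" for x using that by simp
        then have "a \<otimes> x = x \<otimes> a" if "x \<in> carrier R" for x
          using that unfolding C_def by simp
        then have "a \<in> Z" unfolding Z_def using ac by blast
        with a show False by (simp add: NC_def)
      qed
      ultimately have "d < n" using n2 by (meson dvd_imp_le le_neq_implies_less less_le_trans zero_less_numeral)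
      then have "(int q ^ d - 1) * M dvd int q ^ n - 1" using M(2) \<open>d dvd n\<close> by blast
      moreover have "int q ^ n - 1 = (int q ^ d - 1) * int (card (orbit ?G \<phi> a))"
      proof -
        have "int (q ^ k - 1) = int q ^ k - 1" for k
          using q2 by (simp add: of_nat_diff)
        then show ?thesis using arg_cong[OF os, of int] by (simp only: of_nat_mult mult.commute)
      qed
      moreover have "int q ^ d - 1 \<noteq> 0"
      proof
        assume "int q ^ d - 1 = 0"
        then have "q ^ d = 1" by (metis eq_iff_diff_eq_0 of_nat_1 of_nat_eq_iff of_nat_power)
        then show False using \<open>d \<noteq> 0\<close> q2 by simp
      qed
      ultimately have "M dvd int (card (orbit ?G \<phi> a))" by simp
      then show ?thesis by (simp add: nat_abs_dvd_iff)
    qed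
    \<comment> \<open>Central elements are conjugate only to themselves, so the class of a
      non-central element avoids the centre, and the classes partition \<open>NC\<close>.\<close>
    have orbit_NC: "orbit ?G \<phi> a \<subseteq> NC" if a: "a \<in> NC" for a
    proof
      fix y assume y: "y \<in> orbit ?G \<phi> a"
      have aU: "a \<in> Units R" and ac: "a \<in> carrier R" using a NC_units by (auto simp: units_of_carrier NC_def)
      obtain g where g: "g \<in> Units R" "y = g \<otimes> a \<otimes> inv g"
        using y \<phi> aU by (auto simp: orbit_def units_of_carrier)
      have yc: "y \<in> carrier R" using g ac by (simp add: Units_closed Units_inv_closed)
      have "a = inv g \<otimes> y \<otimes> g" unfolding g(2) using g(1) ac
        by (simp add: m_assoc[symmetric] Units_l_inv Units_closed Units_inv_closed)
           (simp add: m_assoc Units_l_inv Units_closed Units_inv_closed)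
      moreover have "inv g \<otimes> y \<otimes> g = y" if "y \<in> Z"
      proof -
        have "inv g \<otimes> y = y \<otimes> inv g" using Zcomm[OF that, of "inv g"] g(1) by (simp add: Units_inv_closed)
        then show ?thesis using g(1) yc by (simp add: m_assoc Units_l_inv Units_closed Units_inv_closed)
      qed
      ultimately have "y \<notin> Z" using a by (auto simp: NC_def)
      with yc show "y \<in> NC" by (simp add: NC_def)
    qed
    let ?O = "orbit ?G \<phi> ` NC"
    have UO: "\<Union>?O = NC"
    proof
      show "\<Union>?O \<subseteq> NC" using orbit_NC by blast
      show "NC \<subseteq> \<Union>?O" using A.orbit_refl NC_units by blast
    qed
    have sub: "orbit ?G \<phi> a \<subseteq> orbit ?G \<phi> b" if "a \<in> NC" "b \<in> NC" "c \<in> orbit ?G \<phi> a" "c \<in> orbit ?G \<phi> b" for a b c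
      using that NC_units orbit_NC by (meson A.orbit_sym A.orbit_trans subset_iff)
    have "nat \<bar>M\<bar> dvd card (\<Union>?O)"
    proof (rule dvd_partition)
      show "finite (\<Union>?O)" unfolding UO using fin by (simp add: NC_def)
      show "\<forall>c\<in>?O. nat \<bar>M\<bar> dvd card c" using dvd_orbit by blast
      show "\<forall>c1\<in>?O. \<forall>c2\<in>?O. c1 \<noteq> c2 \<longrightarrow> c1 \<inter> c2 = {}"
        using sub by (auto; blast)
    qed
    moreover have "card NC = q ^ n - q"
      unfolding NC_def using finZ ZR n by (simp add: card_Diff_subset q_def)
    ultimately have "M dvd int (q ^ n - q)" unfolding UO by (simp add: nat_abs_dvd_iff)
    then have "M dvd int q ^ n - int q" using \<open>q < q ^ n\<close> by (simp add: of_nat_diff)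
    \<comment> \<open>The divisor 1 is proper because n >= 2; dropping its factor q - 1 leaves the
      divisibility by \<open>M\<close>.\<close>
    moreover have "M dvd int q ^ n - 1" using M(2)[of 1] n2 by (auto intro: dvd_mult_right)
    ultimately have "M dvd (int q ^ n - 1) - (int q ^ n - int q)" by (rule dvd_diff[rotated])
    then have "M dvd int q - 1" by simp
    then have "\<bar>M\<bar> \<le> int q - 1" using q2 zdvd_imp_le[of "\<bar>M\<bar>" "int q - 1"] by simp
    with M(1) show False by simp
  qed
  then show ?thesis using assms Zcomm by blast
qed

section \<open>Groups of dilatations and their translations\<close>

text \<open>\<open>dir x y\<close> models the parallel class of the line xy and carries no meaning
  for \<open>x = y\<close>, so the axioms use it for distinct points only. Collinearity is encoded
  as equal directions from a common point. Uniqueness of the parallel is implicit in the equality of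
  directions, so \<open>dir_exists\<close> needs only existence.\<close>

locale affine_directions =
  fixes P :: "'a set" and dir :: "'a \<Rightarrow> 'a \<Rightarrow> 'd"
  assumes finite_points: "finite P"
    and dir_sym: "\<lbrakk>x \<in> P; y \<in> P; x \<noteq> y\<rbrakk> \<Longrightarrow> dir x y = dir y x"
    and dir_collinear: "\<lbrakk>x \<in> P; y \<in> P; z \<in> P; x \<noteq> y; x \<noteq> z; y \<noteq> z; dir x y = dir x z\<rbrakk> \<Longrightarrow> dir y z = dir x y"
    and dir_exists: "\<lbrakk>x \<in> P; y \<in> P; x \<noteq> y; p \<in> P\<rbrakk> \<Longrightarrow> \<exists>z\<in>P. z \<noteq> p \<and> dir p z = dir x y"
    and dir_triangle: "\<lbrakk>a \<in> P; b \<in> P; c \<in> P; a' \<in> P; b' \<in> P; a \<noteq> b; a \<noteq> c; b \<noteq> c; a' \<noteq> b';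
        dir a b \<noteq> dir a c; dir a b = dir a' b'\<rbrakk> \<Longrightarrow>
      \<exists>c'\<in>P. c' \<noteq> a' \<and> c' \<noteq> b' \<and> dir a' c' = dir a c \<and> dir b' c' = dir b c"
    and dir_off: "\<lbrakk>x \<in> P; y \<in> P; x \<noteq> y\<rbrakk> \<Longrightarrow> \<exists>w\<in>P. w \<noteq> x \<and> w \<noteq> y \<and> dir x w \<noteq> dir x y"
begin

text \<open>Two distinct common points u and v would give both lines the direction
  \<open>dir u v\<close>.\<close>

lemma intersection_unique:
  assumes "x \<in> P" "y \<in> P" "u \<in> P" "v \<in> P" "u \<noteq> x" "v \<noteq> x" "u \<noteq> y" "v \<noteq> y"
    and "dir x u = dir x v" "dir y u = dir y v" "dir x u \<noteq> dir y u"
  shows "u = v"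
  using assms dir_collinear[of x u v] dir_collinear[of y u v] by metis

end

text \<open>The schurian condition read pair by pair: \<open>dilatation\<close> confines the orbit
  of a pair to its direction class, \<open>transitive\<close> makes the orbit fill the
  class.\<close>

locale dilatation_group = affine_directions P dir for P :: "'a set" and dir :: "'a \<Rightarrow> 'a \<Rightarrow> 'd" +
  fixes G :: "('a \<Rightarrow> 'a) set"
  assumes group: "perm_group_on P G"
    and dilatation: "\<lbrakk>g \<in> G; x \<in> P; y \<in> P; x \<noteq> y\<rbrakk> \<Longrightarrow> dir (g x) (g y) = dir x y"
    and transitive: "\<lbrakk>x \<in> P; y \<in> P; u \<in> P; v \<in> P; x \<noteq> y; u \<noteq> v; dir x y = dir u v\<rbrakk> \<Longrightarrow>
      \<exists>g\<in>G. g x = u \<and> g y = v"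
begin

lemma permutes: "g \<in> G \<Longrightarrow> g permutes P"
  and id_in: "id \<in> G"
  and comp_in: "\<lbrakk>g \<in> G; h \<in> G\<rbrakk> \<Longrightarrow> g \<circ> h \<in> G"
  using group unfolding perm_group_on_def by blast+

lemma maps: "\<lbrakk>g \<in> G; x \<in> P\<rbrakk> \<Longrightarrow> g x \<in> P"
  using permutes_in_image[OF permutes] by simp

lemma inj: "\<lbrakk>g \<in> G; g x = g y\<rbrakk> \<Longrightarrow> x = y"
  using permutes_inj[OF permutes] by (auto dest: injD)

lemma inv_in: "g \<in> G \<Longrightarrow> Hilbert_Choice.inv g \<in> G"
proof -
  assume g: "g \<in> G"
  then obtain h where h: "h \<in> G" "g \<circ> h = id" using group unfolding perm_group_on_def by blast
  have "bij g" using permutes_bij[OF permutes[OF g]] .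
  then have "h = Hilbert_Choice.inv g" using h(2) by (metis bij_is_inj comp_id inv_o_cancel o_assoc id_comp)
  with h show ?thesis by simp
qed

lemma inv_apply [simp]: "g \<in> G \<Longrightarrow> Hilbert_Choice.inv g (g x) = x" "g \<in> G \<Longrightarrow> g (Hilbert_Choice.inv g x) = x"
  using permutes_inverses[OF permutes] by auto

text \<open>A point off the line of two fixed points is the intersection of its joins with them, and
  the directions of these joins are preserved.\<close>

lemma fixing_two_points:
  assumes g: "g \<in> G" and P: "x \<in> P" "y \<in> P" "x \<noteq> y" and fixed: "g x = x" "g y = y"
  shows "g = id"
proof -
  have off: "g z = z" if P: "a \<in> P" "b \<in> P" "a \<noteq> b" and fixed: "g a = a" "g b = b"
    and z: "z \<in> P" "z \<noteq> a" "z \<noteq> b" "dir a z \<noteq> dir a b" for a b z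
  proof -
    have 1: "dir a (g z) = dir a z" and 2: "dir b (g z) = dir b z"
      using dilatation[OF g P(1) z(1)] dilatation[OF g P(2) z(1)] z fixed by auto
    have "g z \<noteq> a" "g z \<noteq> b" using inj[OF g, of z] z fixed by metis+
    moreover have "dir a z \<noteq> dir b z"
    proof
      assume eq: "dir a z = dir b z"
      have "dir z a = dir z b" using eq dir_sym z P by metis
      then have "dir a b = dir z a" using dir_collinear[of z a b] z P by metis
      then show False using z P dir_sym by metis
    qed
    ultimately show "g z = z"
      using intersection_unique[of a b "g z" z] 1 2 P z maps[OF g z(1)] by metis
  qed
  \<comment> \<open>Points on the line xy need a third fixed point: they lie off the line through
    \<open>x\<close> and \<open>w\<close>.\<close>
  obtain w where w: "w \<in> P" "w \<noteq> x" "w \<noteq> y" "dir x w \<noteq> dir x y" using dir_off P by blast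
  have gw: "g w = w" using off[OF P fixed] w by blast
  have "g z = z" if z: "z \<in> P" for z
  proof (cases "z = x \<or> z = y \<or> dir x z \<noteq> dir x y")
    case True
    then show ?thesis using off[OF P fixed z] fixed by blast
  next
    case False
    then have "dir x z \<noteq> dir x w" "z \<noteq> w" "z \<noteq> x" using w by auto
    then show ?thesis using off[OF P(1) w(1) _ fixed(1) gw z] w by metis
  qed
  moreover have "g z = z" if "z \<notin> P" for z using that permutes[OF g] by (simp add: permutes_def)
  ultimately show ?thesis by (auto simp: fun_eq_iff)
qed

lemma determined_by_two_points:
  assumes "g \<in> G" "h \<in> G" "x \<in> P" "y \<in> P" "x \<noteq> y" "g x = h x" "g y = h y"
  shows "g = h"
proof -
  have "Hilbert_Choice.inv h \<circ> g = id"
    using assms by (intro fixing_two_points[of _ x y] comp_in inv_in) auto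
  then have "h (Hilbert_Choice.inv h (g z)) = h z" for z by (metis comp_apply id_apply)
  then show ?thesis using assms(2) by (auto simp: fun_eq_iff)
qed

section \<open>The translation subgroup\<close>

text \<open>Fixed points are tested in \<open>P\<close> only, because permutations of
  \<open>P\<close> fix everything outside. Closure under composition is not evident from this
  definition; \<open>T_comp\<close> deduces it from \<open>T_determined\<close>.\<close>

definition T :: "('a \<Rightarrow> 'a) set" where
  "T = {g \<in> G. g = id \<or> (\<forall>x\<in>P. g x \<noteq> x)}"

lemma T_G: "\<sigma> \<in> T \<Longrightarrow> \<sigma> \<in> G"
  by (simp add: T_def)

lemma T_moves: "\<lbrakk>\<sigma> \<in> T; \<sigma> \<noteq> id; x \<in> P\<rbrakk> \<Longrightarrow> \<sigma> x \<noteq> x"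
  by (auto simp: T_def)

text \<open>The line through x and g x is mapped to itself, since its image passes through g x and
  has the same direction. Hence every moved point on it has this line as its own trace.\<close>

lemma trace_invariant:
  assumes g: "g \<in> G" and P: "x \<in> P" "z \<in> P" and "g x \<noteq> x" "z \<noteq> x" "dir x z = dir x (g x)" "g z \<noteq> z"
  shows "dir z (g z) = dir x (g x)"
proof -
  have gP: "g x \<in> P" "g z \<in> P" using maps g P by auto
  have d: "dir (g x) (g z) = dir x z" using dilatation[OF g P] assms by metis
  have neq: "g x \<noteq> g z" using inj[OF g, of x z] assms by metis
  show ?thesis
  proof (cases "z = g x")
    case True
    then show ?thesis using d assms by metis
  next
    case False
    have "dir (g x) z = dir x (g x)"
      using dir_collinear[of x "g x" z] P gP assms False by metis
    then have "dir (g x) z = dir (g x) (g z)" using d assms by metis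
    then have "dir z (g z) = dir (g x) z"
      using dir_collinear[of "g x" z "g z"] P gP assms False neq by metis
    then show ?thesis using \<open>dir (g x) z = dir x (g x)\<close> by simp
  qed
qed

text \<open>If the traces of two points were not parallel, then they would meet by the triangle axiom,
  and their intersection would be a fixed point.\<close>

lemma translation_traces_parallel:
  assumes \<sigma>: "\<sigma> \<in> T" "\<sigma> \<noteq> id" and P: "x \<in> P" "y \<in> P"
  shows "dir x (\<sigma> x) = dir y (\<sigma> y)"
proof -
  note g = T_G[OF \<sigma>(1)]
  let ?x = "\<sigma> x" and ?y = "\<sigma> y"
  have moves: "\<sigma> z \<noteq> z" if "z \<in> P" for z using T_moves \<sigma> that by blast
  have gP: "?x \<in> P" "?y \<in> P" using maps g P by auto
  show ?thesis
  proof (cases "y = x \<or> dir x y = dir x ?x")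
    case True
    then show ?thesis using trace_invariant[OF g P] moves P by metis
  next
    case False
    then have xy: "y \<noteq> x" "y \<noteq> ?x" "dir x y \<noteq> dir x ?x" by auto
    have dxy: "dir ?x ?y = dir x y" using dilatation[OF g P] xy by metis
    have neq: "?x \<noteq> ?y" using inj[OF g, of x y] xy by metis
    have "dir y ?x \<noteq> dir y x"
    proof
      assume "dir y ?x = dir y x"
      then have "dir x ?x = dir y x" using dir_collinear[of y x ?x] P gP xy moves by metis
      then show False using xy dir_sym P by metis
    qed
    moreover have "dir y ?x = dir ?x y" using dir_sym P gP xy by metis
    \<comment> \<open>\<open>d\<close> completes the parallelogram on x, \<sigma> x and y: it lies
      on the line through \<sigma> x and \<sigma> y, and its join with y is parallel to the trace of
      x. If it equals \<sigma> y, the traces are parallel at once.\<close>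
    ultimately obtain d where d: "d \<in> P" "d \<noteq> ?x" "d \<noteq> y" "dir ?x d = dir y x" "dir y d = dir ?x x"
      using dir_triangle[of y ?x x ?x y] P gP xy moves by metis
    show ?thesis
    proof (cases "d = ?y")
      case True
      then show ?thesis using d dir_sym P gP moves by metis
    next
      case False
      have dd: "dir d ?y = dir x y"
        using dir_collinear[of ?x d ?y] d dxy dir_sym P gP neq xy False by metis
      have "dir d y \<noteq> dir d ?y"
        using d dd dir_sym P gP xy moves by metis
      \<comment> \<open>The triangle d, \<sigma> y, y is transferred to the base x, y; its new
        vertex lies on the traces of both x and y, so the trace of \<open>c\<close> has both
        directions.\<close>
      then obtain c where c: "c \<in> P" "c \<noteq> x" "c \<noteq> y" "dir x c = dir d y" "dir y c = dir ?y y"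
        using dir_triangle[of d ?y y x y] d dd P gP False xy moves by metis
      have "dir x c = dir x ?x" using c d dir_sym P gP moves by metis
      moreover have "dir y c = dir y ?y" using c dir_sym P gP moves by metis
      ultimately show ?thesis
        using trace_invariant[OF g P(1) c(1)] trace_invariant[OF g P(2) c(1)] c P moves by metis
    qed
  qed
qed

lemma T_inv: "\<sigma> \<in> T \<Longrightarrow> Hilbert_Choice.inv \<sigma> \<in> T"
proof -
  assume \<sigma>: "\<sigma> \<in> T"
  note g = T_G[OF \<sigma>]
  have "Hilbert_Choice.inv \<sigma> = id \<or> (\<forall>x\<in>P. Hilbert_Choice.inv \<sigma> x \<noteq> x)"
  proof (cases "\<sigma> = id")
    case False
    then show ?thesis using T_moves[OF \<sigma>] inv_apply(2)[OF g] by metis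
  qed (simp add: inv_id)
  then show ?thesis using inv_in[OF g] by (simp add: T_def)
qed

text \<open>For \<open>y\<close> off the trace of \<open>x\<close>, the image of \<open>y\<close>
  lies on the parallel to xy through the image of \<open>x\<close> and on the parallel through
  \<open>y\<close> to the trace. These two lines are the same for both translations, which therefore
  agree at two points.\<close>

lemma T_determined:
  assumes "\<sigma> \<in> T" "\<tau> \<in> T" "x \<in> P" "\<sigma> x = \<tau> x"
  shows "\<sigma> = \<tau>"
proof (cases "\<sigma> = id \<or> \<tau> = id")
  case True
  then show ?thesis using T_moves[of \<sigma> x] T_moves[of \<tau> x] assms by fastforce
next
  case False
  note G = T_G[OF assms(1)] T_G[OF assms(2)]
  have sx: "\<sigma> x \<in> P" "\<sigma> x \<noteq> x" using maps G assms T_moves False by auto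
  obtain y where y: "y \<in> P" "y \<noteq> x" "y \<noteq> \<sigma> x" "dir x y \<noteq> dir x (\<sigma> x)"
    using dir_off sx assms by metis
  have yP: "\<sigma> y \<in> P" "\<tau> y \<in> P" using maps G y by auto
  have "\<sigma> y \<noteq> y" "\<tau> y \<noteq> y" using T_moves assms y False by auto
  moreover have "\<sigma> y \<noteq> \<sigma> x" "\<tau> y \<noteq> \<sigma> x" using inj G y assms(4) by metis+
  moreover have "dir y (\<sigma> y) = dir x (\<sigma> x)" "dir y (\<tau> y) = dir x (\<sigma> x)"
    using translation_traces_parallel assms y False by metis+
  moreover have "dir (\<sigma> x) (\<sigma> y) = dir x y" "dir (\<sigma> x) (\<tau> y) = dir x y"
    using dilatation G assms y by metis+
  ultimately have "\<sigma> y = \<tau> y"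
    using intersection_unique[of "\<sigma> x" y "\<sigma> y" "\<tau> y"] sx y yP by metis
  then show ?thesis using determined_by_two_points G assms y by metis
qed

text \<open>If the composite fixes a point x, then \<tau> and the inverse of \<sigma> agree at x,
  hence everywhere by \<open>T_determined\<close>.\<close>

lemma T_comp: "\<lbrakk>\<sigma> \<in> T; \<tau> \<in> T\<rbrakk> \<Longrightarrow> \<sigma> \<circ> \<tau> \<in> T"
proof -
  assume a: "\<sigma> \<in> T" "\<tau> \<in> T"
  have "\<sigma> \<circ> \<tau> = id" if "x \<in> P" "\<sigma> (\<tau> x) = x" for x
  proof -
    have "\<tau> x = Hilbert_Choice.inv \<sigma> x" using arg_cong[OF that(2), of "Hilbert_Choice.inv \<sigma>"] inv_apply(1)[OF T_G[OF a(1)]] by simp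
    then have "\<tau> = Hilbert_Choice.inv \<sigma>" using T_determined a T_inv that by blast
    then show ?thesis using inv_apply(2)[OF T_G[OF a(1)]] by (simp add: fun_eq_iff)
  qed
  then show ?thesis using a comp_in by (auto simp: T_def)
qed

text \<open>The elements of \<open>G\<close> taking \<open>x\<close> to \<open>y\<close> outnumber the possible centres of those among them that
  have a fixed point.\<close>

lemma T_exists:
  assumes P: "x \<in> P" "y \<in> P"
  shows "\<exists>\<sigma>\<in>T. \<sigma> x = y"
proof (cases "x = y")
  case True
  then show ?thesis using id_in by (auto simp: T_def)
next
  case False
  define A where "A = {g \<in> G. g x = y}"
  \<comment> \<open>The points of the line xy other than \<open>y\<close>. Possible centres will lie
    in \<open>Z\<close> without \<open>x\<close>, which has one element fewer.\<close>
  define Z where "Z = {z \<in> P. z \<noteq> y \<and> dir y z = dir x y}"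
  have finZ: "finite Z" using finite_points by (simp add: Z_def)
  have "x \<in> Z" using P False dir_sym by (auto simp: Z_def)
  have "Z \<subseteq> (\<lambda>g. g y) ` A"
  proof
    fix z assume "z \<in> Z"
    then show "z \<in> (\<lambda>g. g y) ` A"
      using transitive[of x y y z] P False by (fastforce simp: Z_def A_def)
  qed
  \<comment> \<open>Some element moves (x, y) to (y, z) for every z in \<open>Z\<close>;
    \<open>B\<close> selects one of them for each z, so it is as large as \<open>Z\<close>.\<close>
  then obtain B where B: "B \<subseteq> A" "inj_on (\<lambda>g. g y) B" "Z = (\<lambda>g. g y) ` B"
    using subset_image_inj by metis
  have "card B = card Z" using B by (simp add: card_image)
  have "\<exists>g\<in>B. \<forall>z\<in>P. g z \<noteq> z"
  proof (rule ccontr)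
    assume "\<not> ?thesis"
    then obtain c where c: "\<And>g. g \<in> B \<Longrightarrow> c g \<in> P \<and> g (c g) = c g" by metis
    have cxy: "c g \<noteq> x" "c g \<noteq> y" if "g \<in> B" for g
      using c[OF that] that B(1) False inj[of g] unfolding A_def by auto
    \<comment> \<open>A fixed point z of g satisfies dir x z = dir y z, so it lies on the line xy.
      Different elements of \<open>B\<close> have different centres, because an element is
      determined by its values at \<open>x\<close> and at its centre.\<close>
    have "c ` B \<subseteq> Z - {x}"
    proof
      fix z assume "z \<in> c ` B"
      then obtain g where g: "g \<in> B" "z = c g" by blast
      then have gG: "g \<in> G" "g x = y" using B by (auto simp: A_def)
      have "dir y z = dir x z" using dilatation[of g x z] gG g c cxy P by metis
      then have "dir z x = dir z y" using dir_sym[of z] g c cxy P by metis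
      then have "dir x y = dir z x" using dir_collinear[of z x y] g c cxy P False by metis
      then have "dir y z = dir x y" using dir_sym[of y z] g c cxy P \<open>dir z x = dir z y\<close> by metis
      then show "z \<in> Z - {x}" using g c cxy by (simp add: Z_def)
    qed
    moreover have "inj_on c B"
    proof (rule inj_onI)
      fix g h assume gh: "g \<in> B" "h \<in> B" "c g = c h"
      then have "g \<in> G" "h \<in> G" "g x = h x" using B by (auto simp: A_def)
      then show "g = h" using determined_by_two_points[of g h x "c g"] gh c cxy P by metis
    qed
    ultimately have "card B \<le> card (Z - {x})" using finZ by (metis card_inj_on_le finite_Diff)
    also have "\<dots> < card Z" using \<open>x \<in> Z\<close> finZ by (rule card_Diff1_less[rotated])
    finally show False using \<open>card B = card Z\<close> by simp
  qed
  then show ?thesis using B(1) by (auto simp: T_def A_def)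
qed

text \<open>Both composites send \<open>x\<close> to the fourth vertex of the parallelogram spanned
  by \<sigma> x and \<tau> x, and a translation is determined by one value.\<close>

lemma T_commute_distinct_directions:
  assumes "\<sigma> \<in> T" "\<tau> \<in> T" "x \<in> P" "\<sigma> \<noteq> id" "\<tau> \<noteq> id" "dir x (\<sigma> x) \<noteq> dir x (\<tau> x)"
  shows "\<sigma> \<circ> \<tau> = \<tau> \<circ> \<sigma>"
proof -
  note G = T_G[OF assms(1)] T_G[OF assms(2)]
  have P: "\<sigma> x \<in> P" "\<tau> x \<in> P" "\<sigma> (\<tau> x) \<in> P" "\<tau> (\<sigma> x) \<in> P" using maps G assms by auto
  have moves: "\<sigma> z \<noteq> z" "\<tau> z \<noteq> z" if "z \<in> P" for z using T_moves assms that by auto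
  have neq: "\<sigma> x \<noteq> \<sigma> (\<tau> x)" "\<tau> x \<noteq> \<tau> (\<sigma> x)" using inj G moves assms(3) by metis+
  have "dir (\<sigma> x) (\<sigma> (\<tau> x)) = dir x (\<tau> x)" "dir (\<tau> x) (\<tau> (\<sigma> x)) = dir x (\<sigma> x)"
    using dilatation G P assms moves by metis+
  moreover have "dir (\<tau> x) (\<sigma> (\<tau> x)) = dir x (\<sigma> x)" "dir (\<sigma> x) (\<tau> (\<sigma> x)) = dir x (\<tau> x)"
    using translation_traces_parallel assms P by metis+
  ultimately have "\<sigma> (\<tau> x) = \<tau> (\<sigma> x)"
    using intersection_unique[of "\<sigma> x" "\<tau> x" "\<sigma> (\<tau> x)" "\<tau> (\<sigma> x)"] P neq moves assms by metis
  then show ?thesis using T_determined[of "\<sigma> \<circ> \<tau>" "\<tau> \<circ> \<sigma>" x] T_comp assms by auto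
qed

text \<open>Equal directions are handled by a detour through a translation \<rho> with another
  direction: \<sigma> commutes with \<rho> and with \<rho> \<circ> \<tau>, whose direction also
  differs from that of \<sigma>, and then \<rho> can be cancelled.\<close>

lemma T_commute:
  assumes "\<sigma> \<in> T" "\<tau> \<in> T" shows "\<sigma> \<circ> \<tau> = \<tau> \<circ> \<sigma>"
proof (cases "\<sigma> = id \<or> \<tau> = id \<or> P = {}")
  case True
  then show ?thesis
    using permutes[OF T_G[OF assms(1)]] permutes[OF T_G[OF assms(2)]] by auto
next
  case False
  then obtain x where x: "x \<in> P" by blast
  have sx: "\<sigma> x \<in> P" "\<sigma> x \<noteq> x" using x maps T_G assms T_moves False by auto
  show ?thesis
  proof (cases "dir x (\<sigma> x) = dir x (\<tau> x)")
    case False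
    then show ?thesis using T_commute_distinct_directions assms x \<open>\<not> (\<sigma> = id \<or> _)\<close> by blast
  next
    case same: True
    obtain w where w: "w \<in> P" "w \<noteq> x" "w \<noteq> \<sigma> x" "dir x w \<noteq> dir x (\<sigma> x)" using dir_off sx x by metis
    obtain \<rho> where \<rho>: "\<rho> \<in> T" "\<rho> x = w" using T_exists x w by blast
    have "\<rho> \<noteq> id" using \<rho> w by auto
    have \<rho>\<sigma>: "\<rho> \<circ> \<sigma> = \<sigma> \<circ> \<rho>"
      using T_commute_distinct_directions[OF \<rho>(1) assms(1) x] \<open>\<rho> \<noteq> id\<close> \<rho> w False by auto
    have tx: "\<tau> x \<in> P" "\<tau> x \<noteq> x" using x maps T_G assms T_moves False by auto
    have \<rho>\<tau>: "\<rho> \<circ> \<tau> \<in> T" using \<rho> assms T_comp by blast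
    have "dir (\<tau> x) (\<rho> (\<tau> x)) = dir x w"
      using translation_traces_parallel[OF \<rho>(1) \<open>\<rho> \<noteq> id\<close> tx(1) x] \<rho> by simp
    have r: "\<rho> (\<tau> x) \<in> P" "\<rho> (\<tau> x) \<noteq> \<tau> x" using \<rho> tx maps T_G T_moves \<open>\<rho> \<noteq> id\<close> by auto
    have "\<rho> (\<tau> x) \<noteq> x"
    proof
      assume "\<rho> (\<tau> x) = x"
      then have "dir x w = dir x (\<tau> x)"
        using \<open>dir (\<tau> x) (\<rho> (\<tau> x)) = dir x w\<close> dir_sym tx x by metis
      then show False using same w by simp
    qed
    moreover have "dir x (\<rho> (\<tau> x)) \<noteq> dir x (\<sigma> x)"
    proof
      assume "dir x (\<rho> (\<tau> x)) = dir x (\<sigma> x)"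
      then have "dir (\<tau> x) (\<rho> (\<tau> x)) = dir x (\<tau> x)"
        using dir_collinear[of x "\<tau> x" "\<rho> (\<tau> x)"] same tx x r calculation by metis
      then show False using \<open>dir (\<tau> x) (\<rho> (\<tau> x)) = dir x w\<close> same w by simp
    qed
    moreover have "\<rho> \<circ> \<tau> \<noteq> id" using calculation(1) by (metis comp_apply id_apply)
    ultimately have "\<sigma> \<circ> (\<rho> \<circ> \<tau>) = (\<rho> \<circ> \<tau>) \<circ> \<sigma>"
      using T_commute_distinct_directions[OF assms(1) \<rho>\<tau> x] False by (simp add: eq_commute)
    then have "\<rho> (\<sigma> (\<tau> z)) = \<rho> (\<tau> (\<sigma> z))" for z
      using \<rho>\<sigma> by (metis comp_apply)
    then have "\<sigma> (\<tau> z) = \<tau> (\<sigma> z)" for z using inj[OF T_G[OF \<rho>(1)]] by blast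
    then show ?thesis by (simp add: fun_eq_iff)
  qed
qed

text \<open>The inverse of \<open>g\<close> carries a fixed point of the conjugate to a fixed point
  of \<sigma>. This normality later makes the elements fixing the origin additive.\<close>

lemma T_conj:
  assumes g: "g \<in> G" and "\<sigma> \<in> T" shows "g \<circ> \<sigma> \<circ> Hilbert_Choice.inv g \<in> T"
proof -
  have "g \<circ> \<sigma> \<circ> Hilbert_Choice.inv g \<in> G" using comp_in inv_in T_G assms by blast
  moreover have "g \<circ> \<sigma> \<circ> Hilbert_Choice.inv g = id" if "x \<in> P" "g (\<sigma> (Hilbert_Choice.inv g x)) = x" for x
  proof -
    have "\<sigma> (Hilbert_Choice.inv g x) = Hilbert_Choice.inv g x" using arg_cong[OF that(2), of "Hilbert_Choice.inv g"] inv_apply(1)[OF g] by simp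
    moreover have "Hilbert_Choice.inv g x \<in> P" using maps inv_in that g by blast
    ultimately have "\<sigma> = id" using T_moves assms by blast
    then show ?thesis using g by (auto simp: fun_eq_iff)
  qed
  ultimately show ?thesis unfolding T_def by (auto simp: comp_def)
qed

end

section \<open>Coordinates\<close>

locale pointed_dilatation_group = dilatation_group P dir G
  for P :: "'a set" and dir :: "'a \<Rightarrow> 'a \<Rightarrow> 'd" and G +
  fixes z0 :: 'a
  assumes z0: "z0 \<in> P" and nontrivial: "\<exists>w\<in>P. w \<noteq> z0"
begin

section \<open>The additive group of points\<close>

definition tr :: "'a \<Rightarrow> 'a \<Rightarrow> 'a" where
  "tr x = (THE \<sigma>. \<sigma> \<in> T \<and> \<sigma> z0 = x)"

lemma tr:
  assumes "x \<in> P" shows tr_T: "tr x \<in> T" and tr_z0: "tr x z0 = x"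
proof -
  have "\<exists>!\<sigma>. \<sigma> \<in> T \<and> \<sigma> z0 = x"
    using T_exists[OF z0 assms] T_determined[OF _ _ z0] by metis
  from theI'[OF this] show "tr x \<in> T" "tr x z0 = x" by (simp_all add: tr_def)
qed

lemma tr_eqI: "\<lbrakk>\<sigma> \<in> T; \<sigma> z0 = x\<rbrakk> \<Longrightarrow> tr x = \<sigma>"
  using T_determined[OF tr_T _ z0] tr_z0 maps[OF T_G z0] by metis

definition padd :: "'a \<Rightarrow> 'a \<Rightarrow> 'a" (infixl \<open>\<^bold>+\<close> 65) where
  "x \<^bold>+ y = tr x y"

definition neg :: "'a \<Rightarrow> 'a" where
  "neg x = Hilbert_Choice.inv (tr x) z0"

lemma plus_closed: "\<lbrakk>x \<in> P; y \<in> P\<rbrakk> \<Longrightarrow> x \<^bold>+ y \<in> P"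
  unfolding padd_def using maps T_G tr_T by blast

lemma neg_closed: "x \<in> P \<Longrightarrow> neg x \<in> P"
  unfolding neg_def using maps[OF inv_in[OF T_G[OF tr_T]] z0] .

lemma plus_zero_right: "x \<in> P \<Longrightarrow> x \<^bold>+ z0 = x"
  by (simp add: padd_def tr_z0)

lemma plus_commute: "\<lbrakk>x \<in> P; y \<in> P\<rbrakk> \<Longrightarrow> x \<^bold>+ y = y \<^bold>+ x"
  using T_commute[OF tr_T tr_T, of x y] tr_z0[of x] tr_z0[of y]
  unfolding padd_def by (metis comp_apply)

lemma plus_zero_left: "x \<in> P \<Longrightarrow> z0 \<^bold>+ x = x"
  using plus_commute[OF z0, of x] plus_zero_right by simp

lemma tr_plus: "\<lbrakk>x \<in> P; y \<in> P\<rbrakk> \<Longrightarrow> tr (x \<^bold>+ y) = tr x \<circ> tr y"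
  by (rule tr_eqI) (auto intro: T_comp tr_T simp: padd_def tr_z0)

lemma plus_assoc: "\<lbrakk>x \<in> P; y \<in> P\<rbrakk> \<Longrightarrow> (x \<^bold>+ y) \<^bold>+ z = x \<^bold>+ (y \<^bold>+ z)"
  using tr_plus[of x y] by (simp add: padd_def)

lemma plus_neg: "x \<in> P \<Longrightarrow> x \<^bold>+ neg x = z0"
  unfolding padd_def neg_def using inv_apply(2)[OF T_G[OF tr_T]] by simp

lemma plus_neg_left: "x \<in> P \<Longrightarrow> neg x \<^bold>+ x = z0"
  using plus_commute[of x "neg x"] plus_neg neg_closed by simp

lemma plus_left_cancel: "\<lbrakk>x \<in> P; x \<^bold>+ y = x \<^bold>+ z\<rbrakk> \<Longrightarrow> y = z"
  unfolding padd_def using inj T_G tr_T by blast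

lemma dir_plus: "\<lbrakk>x \<in> P; y \<in> P; z \<in> P; y \<noteq> z\<rbrakk> \<Longrightarrow> dir (x \<^bold>+ y) (x \<^bold>+ z) = dir y z"
  unfolding padd_def using dilatation T_G tr_T by blast

lemma dir_neg: "\<lbrakk>x \<in> P; x \<noteq> z0\<rbrakk> \<Longrightarrow> dir z0 (neg x) = dir z0 x"
  using dir_plus[of "neg x" x z0] plus_neg_left plus_zero_right neg_closed z0 dir_sym[of x z0] by simp

lemma neg_nonzero: "\<lbrakk>x \<in> P; x \<noteq> z0\<rbrakk> \<Longrightarrow> neg x \<noteq> z0"
  using plus_neg[of x] plus_zero_right by metis

text \<open>The pair (x, x + y) is the translate by x of the pair formed by the origin and y, so x +
  y stays on the line through the origin and x.\<close>

lemma dir_sum: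
  assumes "x \<in> P" "y \<in> P" "x \<noteq> z0" "y \<noteq> z0" "dir z0 x = dir z0 y" "x \<^bold>+ y \<noteq> z0"
  shows "dir z0 (x \<^bold>+ y) = dir z0 x"
proof -
  have P: "x \<^bold>+ y \<in> P" using assms plus_closed by blast
  have "dir x (x \<^bold>+ y) = dir z0 y"
    using dir_plus[of x z0 y] assms z0 plus_zero_right by simp
  moreover have "x \<^bold>+ y \<noteq> x" using plus_left_cancel[of x y z0] plus_zero_right assms by metis
  ultimately show ?thesis
    using dir_collinear[of x z0 "x \<^bold>+ y"] assms P z0 dir_sym by metis
qed

lemma plus_neg_cancel: "\<lbrakk>x \<in> P; y \<in> P\<rbrakk> \<Longrightarrow> (x \<^bold>+ y) \<^bold>+ neg y = x"
  by (simp add: plus_assoc neg_closed plus_neg plus_zero_right)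

text \<open>The kernel of the translation group: the scalars of the coordinatization.\<close>

definition D :: "('a \<Rightarrow> 'a) ring" where
  "D = \<lparr>carrier = {f \<in> extensional P. (\<forall>x\<in>P. f x \<in> P) \<and> (\<forall>x\<in>P. \<forall>y\<in>P. f (x \<^bold>+ y) = f x \<^bold>+ f y)
          \<and> (\<forall>x\<in>P. x \<noteq> z0 \<longrightarrow> f x \<noteq> z0 \<longrightarrow> dir z0 (f x) = dir z0 x)},
     monoid.mult = (\<lambda>f g. \<lambda>x\<in>P. f (g x)), one = (\<lambda>x\<in>P. x), zero = (\<lambda>x\<in>P. z0),
     add = (\<lambda>f g. \<lambda>x\<in>P. f x \<^bold>+ g x)\<rparr>"

lemma D_simps [simp]:
  "monoid.mult D f g = (\<lambda>x\<in>P. f (g x))" "one D = (\<lambda>x\<in>P. x)" "zero D = (\<lambda>x\<in>P. z0)"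
  "add D f g = (\<lambda>x\<in>P. f x \<^bold>+ g x)"
  by (simp_all add: D_def)

lemma D_carrierI:
  assumes "f \<in> extensional P" "\<And>x. x \<in> P \<Longrightarrow> f x \<in> P"
    "\<And>x y. \<lbrakk>x \<in> P; y \<in> P\<rbrakk> \<Longrightarrow> f (x \<^bold>+ y) = f x \<^bold>+ f y"
    "\<And>x. \<lbrakk>x \<in> P; x \<noteq> z0; f x \<noteq> z0\<rbrakk> \<Longrightarrow> dir z0 (f x) = dir z0 x"
  shows "f \<in> carrier D"
  using assms by (simp add: D_def)

lemma D_carrierD:
  assumes "f \<in> carrier D"
  shows D_ext: "f \<in> extensional P" and D_closed: "x \<in> P \<Longrightarrow> f x \<in> P"
    and D_plus: "\<lbrakk>x \<in> P; y \<in> P\<rbrakk> \<Longrightarrow> f (x \<^bold>+ y) = f x \<^bold>+ f y"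
    and D_dir: "\<lbrakk>x \<in> P; x \<noteq> z0; f x \<noteq> z0\<rbrakk> \<Longrightarrow> dir z0 (f x) = dir z0 x"
  using assms by (auto simp: D_def)

lemma D_z0: "f \<in> carrier D \<Longrightarrow> f z0 = z0"
  using D_plus[of f z0 z0] plus_left_cancel[of "f z0" "f z0" z0] D_closed[of f z0] z0
  by (simp add: plus_zero_right)

text \<open>The condition \<open>extensional P\<close> in the carrier of \<open>D\<close> serves
  this purpose; it also makes the carrier finite.\<close>

lemma D_eqI: "\<lbrakk>f \<in> carrier D; g \<in> carrier D; \<And>x. x \<in> P \<Longrightarrow> f x = g x\<rbrakk> \<Longrightarrow> f = g"
  by (rule extensionalityI[of _ P]) (auto intro: D_ext)

lemma plus_left_commute: "\<lbrakk>x \<in> P; y \<in> P; z \<in> P\<rbrakk> \<Longrightarrow> x \<^bold>+ (y \<^bold>+ z) = y \<^bold>+ (x \<^bold>+ z)"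
  using plus_assoc[of x y z] plus_assoc[of y x z] plus_commute[of x y] by simp

lemma D_add_closed:
  assumes "f \<in> carrier D" "g \<in> carrier D" shows "add D f g \<in> carrier D"
proof (rule D_carrierI)
  fix x assume x: "x \<in> P"
  show "add D f g x \<in> P" using x assms by (simp add: plus_closed D_closed)
  show "add D f g (x \<^bold>+ y) = add D f g x \<^bold>+ add D f g y" if "y \<in> P" for y
    using x that assms
    by (simp add: plus_closed D_closed D_plus plus_assoc plus_left_commute)
  assume nz: "x \<noteq> z0" "add D f g x \<noteq> z0"
  then have nz': "f x \<^bold>+ g x \<noteq> z0" using x by simp
  show "dir z0 (add D f g x) = dir z0 x"
  proof (cases "f x = z0 \<or> g x = z0")
    case True
    then show ?thesis
    proof
      assume fx: "f x = z0"
      then have "g x \<noteq> z0" using nz' plus_zero_left[OF z0] by metis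
      then show ?thesis using fx x nz(1) assms by (simp add: plus_zero_left D_closed D_dir)
    next
      assume gx: "g x = z0"
      then have "f x \<noteq> z0" using nz' plus_zero_left[OF z0] by metis
      then show ?thesis using gx x nz(1) assms by (simp add: plus_zero_right D_closed D_dir)
    qed
  next
    case False
    then show ?thesis
      using dir_sum[of "f x" "g x"] nz' x nz(1) assms by (simp add: D_closed D_dir)
  qed
qed simp

lemma D_mult_closed:
  assumes "f \<in> carrier D" "g \<in> carrier D" shows "monoid.mult D f g \<in> carrier D"
proof (rule D_carrierI)
  fix x assume x: "x \<in> P"
  show "monoid.mult D f g x \<in> P" using x assms by (simp add: D_closed)
  show "monoid.mult D f g (x \<^bold>+ y) = monoid.mult D f g x \<^bold>+ monoid.mult D f g y" if "y \<in> P" for y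
    using x that assms by (simp add: plus_closed D_closed D_plus)
  assume nz: "x \<noteq> z0" "monoid.mult D f g x \<noteq> z0"
  then have "g x \<noteq> z0" using x D_z0[OF assms(1)] by (metis D_simps(1) restrict_apply')
  then show "dir z0 (monoid.mult D f g x) = dir z0 x"
    using x nz assms D_dir[of f "g x"] D_dir[of g x] by (simp add: D_closed)
qed simp

lemma ring_D: "ring D"
proof (rule ringI)
  have zero: "zero D \<in> carrier D"
    by (rule D_carrierI) (simp_all add: z0 plus_closed plus_zero_left)
  show "abelian_group D"
  proof (rule abelian_groupI)
    show "\<exists>g\<in>carrier D. add D g f = zero D" if f: "f \<in> carrier D" for f
    proof (rule bexI)
      let ?g = "\<lambda>x\<in>P. neg (f x)"
      have neg_plus: "neg (a \<^bold>+ b) = neg a \<^bold>+ neg b" if ab: "a \<in> P" "b \<in> P" for a b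
      proof (rule plus_left_cancel)
        show "a \<^bold>+ b \<in> P" using ab by (rule plus_closed)
        have "(a \<^bold>+ b) \<^bold>+ (neg a \<^bold>+ neg b) = (a \<^bold>+ neg a) \<^bold>+ (b \<^bold>+ neg b)"
          using ab by (simp add: plus_assoc plus_left_commute plus_closed neg_closed)
        then show "a \<^bold>+ b \<^bold>+ neg (a \<^bold>+ b) = a \<^bold>+ b \<^bold>+ (neg a \<^bold>+ neg b)"
          using ab by (simp add: plus_neg plus_closed plus_zero_left z0)
      qed
      show "add D ?g f = zero D" using f by (simp add: fun_eq_iff plus_neg_left D_closed)
      show "?g \<in> carrier D"
      proof (rule D_carrierI)
        fix x assume x: "x \<in> P"
        show "?g x \<in> P" using f x by (simp add: neg_closed D_closed)
        show "?g (x \<^bold>+ y) = ?g x \<^bold>+ ?g y" if "y \<in> P" for y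
          using f x that by (simp add: plus_closed D_plus neg_plus D_closed)
        assume nz: "x \<noteq> z0" "?g x \<noteq> z0"
        have "neg z0 = z0" using plus_neg[OF z0] plus_zero_left[OF neg_closed[OF z0]] by simp
        then have "f x \<noteq> z0" using nz x by (metis restrict_apply')
        then show "dir z0 (?g x) = dir z0 x"
          using f x nz by (simp add: dir_neg D_closed D_dir)
      qed simp
    qed
  next
    show "add D (zero D) f = f" if "f \<in> carrier D" for f
      using that zero by (intro D_eqI D_add_closed) (simp_all add: plus_zero_left D_closed)
    show "add D f g = add D g f" if "f \<in> carrier D" "g \<in> carrier D" for f g
      using that by (auto simp: fun_eq_iff D_closed intro: plus_commute)
    show "add D (add D f g) h = add D f (add D g h)"
      if "f \<in> carrier D" "g \<in> carrier D" "h \<in> carrier D" for f g h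
      using that by (simp add: fun_eq_iff plus_assoc D_closed)
  qed (use zero D_add_closed in auto)
  have one: "one D \<in> carrier D"
    by (rule D_carrierI) (simp_all add: plus_closed)
  show "Group.monoid D"
  proof (rule monoidI)
    show "monoid.mult D (monoid.mult D f g) h = monoid.mult D f (monoid.mult D g h)"
      if "f \<in> carrier D" "g \<in> carrier D" "h \<in> carrier D" for f g h
      using that by (simp add: fun_eq_iff D_closed)
    show "monoid.mult D (one D) f = f" "monoid.mult D f (one D) = f" if f: "f \<in> carrier D" for f
      using D_eqI[OF D_mult_closed[OF one f] f] D_eqI[OF D_mult_closed[OF f one] f] f
      by (simp_all add: D_closed)
  qed (use one D_mult_closed in auto)
  fix f g h assume "f \<in> carrier D" "g \<in> carrier D" "h \<in> carrier D"
  then show "monoid.mult D (add D f g) h = add D (monoid.mult D f h) (monoid.mult D g h)"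
    and "monoid.mult D h (add D f g) = add D (monoid.mult D h f) (monoid.mult D h g)"
    by (simp_all add: fun_eq_iff D_closed D_plus)
qed

text \<open>If f kills u and y has another direction, then f (u + y) = f y. A nonzero value would
  give u + y and y the same direction, which would then also be that of u, the difference of the
  two.\<close>

lemma D_injective:
  assumes f: "f \<in> carrier D" and x: "x \<in> P" "x \<noteq> z0" "f x = z0"
  shows "f = zero D"
proof -
  have off: "f y = z0" if u: "u \<in> P" "u \<noteq> z0" "f u = z0"
    and y: "y \<in> P" "y \<noteq> z0" "dir z0 y \<noteq> dir z0 u" for u y
  proof (rule ccontr)
    assume fy: "f y \<noteq> z0"
    have uy: "u \<^bold>+ y \<in> P" using u y plus_closed by blast
    have uy0: "u \<^bold>+ y \<noteq> z0"
    proof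
      assume "u \<^bold>+ y = z0"
      then have "y = neg u" using plus_left_cancel[of u y "neg u"] plus_neg u by simp
      then show False using dir_neg u y by simp
    qed
    have "f (u \<^bold>+ y) = f y" using D_plus[OF f] u y D_closed[OF f] by (simp add: plus_zero_left)
    then have same: "dir z0 (u \<^bold>+ y) = dir z0 y"
      using D_dir[OF f uy uy0] D_dir[OF f y(1,2)] fy by simp
    have "(u \<^bold>+ y) \<^bold>+ neg y = u" using plus_neg_cancel u y by blast
    then have "dir z0 u = dir z0 (u \<^bold>+ y)"
      using dir_sum[OF uy neg_closed[OF y(1)] uy0 neg_nonzero[OF y(1,2)]] same dir_neg[OF y(1,2)] u by simp
    then show False using same y by simp
  qed
  \<comment> \<open>Points on the line through the origin and \<open>x\<close> are treated from a
    killed point off that line.\<close>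
  obtain w where w: "w \<in> P" "w \<noteq> z0" "dir z0 w \<noteq> dir z0 x" using dir_off[OF z0 x(1)] x by metis
  have fw: "f w = z0" using off[OF x] w by blast
  have "f y = z0" if y: "y \<in> P" for y
  proof (cases "y = z0")
    case True
    then show ?thesis using D_z0[OF f] by simp
  next
    case False
    then show ?thesis using off[OF x y] off[OF w(1,2) fw y] w(3) by metis
  qed
  then show ?thesis using D_eqI[OF f abelian_monoid.zero_closed] ring.is_abelian_group[OF ring_D]
    abelian_group.axioms(1) by auto
qed

text \<open>A nonzero scalar has trivial kernel by \<open>D_injective\<close>, so it is injective
  and, on finitely many points, bijective; its inverse is again additive and keeps the lines through
  the origin.\<close>

lemma D_units: "Units D = carrier D - {zero D}"
proof (intro equalityI subsetI)
  interpret D: ring D by (rule ring_D)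
  fix f assume f: "f \<in> Units D"
  obtain w where w: "w \<in> P" "w \<noteq> z0" using nontrivial by blast
  have "f \<noteq> zero D"
  proof
    assume "f = zero D"
    then have "one D = zero D" using D.Units_r_inv[OF f] D.Units_inv_closed[OF f] by (metis D.l_null)
    then show False using w by (metis D_simps(2,3) restrict_apply')
  qed
  then show "f \<in> carrier D - {zero D}" using f D.Units_closed by simp
next
  interpret D: ring D by (rule ring_D)
  fix f assume f: "f \<in> carrier D - {zero D}"
  then have fD: "f \<in> carrier D" by simp
  have inj: "inj_on f P"
  proof (rule inj_onI)
    fix x y assume xy: "x \<in> P" "y \<in> P" "f x = f y"
    have n: "neg y \<in> P" "x \<^bold>+ neg y \<in> P" using xy neg_closed plus_closed by auto
    have "f (x \<^bold>+ neg y) = f (y \<^bold>+ neg y)" using D_plus[OF fD] xy n by simp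
    then have "f (x \<^bold>+ neg y) = z0" using plus_neg xy D_z0[OF fD] by simp
    then have "x \<^bold>+ neg y = z0" using D_injective[OF fD n(2)] f by blast
    then have "neg y \<^bold>+ x = neg y \<^bold>+ y" using plus_commute[OF xy(1) n(1)] plus_neg_left xy by simp
    then show "x = y" using plus_left_cancel n by blast
  qed
  have img: "f ` P = P"
    using endo_inj_surj[OF finite_points _ inj] D_closed[OF fD] by blast
  let ?g = "\<lambda>x\<in>P. inv_into P f x"
  have gP: "?g x \<in> P" "f (?g x) = x" if "x \<in> P" for x
    using that img by (simp_all add: inv_into_into f_inv_into_f)
  have fg: "?g (f x) = x" if "x \<in> P" for x
    using that inj D_closed[OF fD] by simp
  have g: "?g \<in> carrier D"
  proof (rule D_carrierI)
    fix x assume x: "x \<in> P"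
    show "?g x \<in> P" using gP x by blast
    show "?g (x \<^bold>+ y) = ?g x \<^bold>+ ?g y" if y: "y \<in> P" for y
    proof (rule inj_onD[OF inj])
      show "f (?g (x \<^bold>+ y)) = f (?g x \<^bold>+ ?g y)"
        using D_plus[OF fD gP(1)[OF x] gP(1)[OF y]] gP(2)[OF x] gP(2)[OF y] gP(2)[OF plus_closed[OF x y]] by simp
    qed (use gP x y plus_closed in blast)+
    assume "x \<noteq> z0" "?g x \<noteq> z0"
    then show "dir z0 (?g x) = dir z0 x" using D_dir[OF fD gP(1)[OF x]] gP(2)[OF x] by simp
  qed simp
  have "monoid.mult D f ?g = one D" "monoid.mult D ?g f = one D"
    using gP fg by (simp_all only: D_simps fun_eq_iff restrict_apply) auto
  then show "f \<in> Units D" unfolding Units_def using fD g by blast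
qed

text \<open>The stabilizer of the origin in \<open>G\<close> supplies the scalar: conjugation by
  such a g takes the translation of u to that of g u, so g is additive.\<close>

lemma D_transitive:
  assumes x: "x \<in> P" "x \<noteq> z0" and y: "y \<in> P" "y = z0 \<or> dir z0 y = dir z0 x"
  shows "\<exists>f\<in>carrier D. f x = y"
proof (cases "y = z0")
  case True
  interpret D: ring D by (rule ring_D)
  show ?thesis using True x D.zero_closed by (intro bexI[of _ "zero D"]) auto
next
  case False
  then obtain g where g: "g \<in> G" "g z0 = z0" "g x = y"
    using transitive[of z0 x z0 y] x y z0 by metis
  have "restrict g P \<in> carrier D"
  proof (rule D_carrierI)
    fix u assume u: "u \<in> P"
    show "restrict g P u \<in> P" using u maps g by simp
    have conj: "tr (g u) = g \<circ> tr u \<circ> Hilbert_Choice.inv g"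
    proof (rule tr_eqI)
      have "Hilbert_Choice.inv g z0 = z0" using inv_apply(1)[OF g(1), of z0] g(2) by simp
      then show "(g \<circ> tr u \<circ> Hilbert_Choice.inv g) z0 = g u" using tr_z0 u by simp
    qed (use T_conj g tr_T u in blast)
    show "restrict g P (u \<^bold>+ v) = restrict g P u \<^bold>+ restrict g P v" if v: "v \<in> P" for v
      using u v g plus_closed[OF u v] by (simp add: padd_def conj)
    assume "u \<noteq> z0"
    then show "dir z0 (restrict g P u) = dir z0 u"
      using dilatation[OF g(1) z0 u] g u by simp
  qed simp
  then show ?thesis using g x by (intro bexI[of _ "restrict g P"]) auto
qed

end

lemma AG_points_eq_coords: "AG_points n F = coords n F"
  by (simp add: AG_points_def coords_def)

section \<open>The field of scalars and coordinates over it\<close>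

context pointed_dilatation_group
begin

lemma field_D: "field D" and finite_D: "finite (carrier D)"
proof -
  interpret D: ring D by (rule ring_D)
  have "f \<in> PiE P (\<lambda>_. P)" if "f \<in> carrier D" for f
    using D_ext[OF that] D_closed[OF that] by (simp add: PiE_iff)
  then have "carrier D \<subseteq> PiE P (\<lambda>_. P)" by blast
  then show fin: "finite (carrier D)" using finite_points by (meson finite_PiE finite_subset)
  have "cring D"
    by (intro cringI comm_monoid.intro D.monoid_axioms comm_monoid_axioms.intro
        D.wedderburn_little[OF fin D_units] D.is_abelian_group D.l_distr)
  then show "field D" using D_units by (rule cring.cring_fieldI)
qed

text \<open>\<open>D_dir\<close> and \<open>D_transitive\<close> give the two inclusions. In other
  words, the lines through the origin are the one-dimensional subspaces.\<close>

lemma D_orbit: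
  assumes "w \<in> P" "w \<noteq> z0"
  shows "{f w | f. f \<in> carrier D} = {z \<in> P. z = z0 \<or> dir z0 z = dir z0 w}"
proof (intro equalityI subsetI)
  fix z assume "z \<in> {f w | f. f \<in> carrier D}"
  then obtain f where f: "f \<in> carrier D" "z = f w" by blast
  then show "z \<in> {z \<in> P. z = z0 \<or> dir z0 z = dir z0 w}"
    using D_closed[OF f(1) assms(1)] D_dir[OF f(1) assms] by (cases "z = z0") auto
next
  fix z assume "z \<in> {z \<in> P. z = z0 \<or> dir z0 z = dir z0 w}"
  then show "z \<in> {f w | f. f \<in> carrier D}" using D_transitive[OF assms, of z] by auto
qed

text \<open>Translations preserve directions, so knowledge of the lines through the origin suffices;
  \<open>w\<close> plays the role of a direction vector.\<close>

lemma line_as_translate: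
  assumes p: "p \<in> P" and w: "w \<in> P" "w \<noteq> z0"
  shows "(\<lambda>z. p \<^bold>+ z) ` {z \<in> P. z = z0 \<or> dir z0 z = dir z0 w} =
    {y \<in> P. y = p \<or> dir p y = dir z0 w}" (is "?f ` ?A = ?B")
proof
  have dir: "dir p (p \<^bold>+ z) = dir z0 z" if "z \<in> P" "z \<noteq> z0" for z
    using dir_plus[OF p z0 that(1)] that plus_zero_right[OF p] by simp
  show "?f ` ?A \<subseteq> ?B"
  proof (rule image_subsetI)
    fix z assume z: "z \<in> ?A"
    then show "p \<^bold>+ z \<in> ?B"
      using dir[of z] plus_closed[OF p, of z] plus_zero_right[OF p] by (cases "z = z0") auto
  qed
  show "?B \<subseteq> ?f ` ?A"
  proof
    fix y assume y: "y \<in> ?B"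
    then have yP: "y \<in> P" by simp
    define z where "z = neg p \<^bold>+ y"
    have zP: "z \<in> P" using p y by (simp add: z_def neg_closed plus_closed)
    have yz: "y = p \<^bold>+ z"
      using plus_assoc[OF p neg_closed[OF p], of y] plus_neg[OF p] plus_zero_left[OF yP] by (simp add: z_def)
    have "z = z0 \<or> dir z0 z = dir z0 w"
    proof (cases "z = z0")
      case False
      then have "y \<noteq> p" using yz plus_left_cancel[OF p, of z z0] plus_zero_right[OF p] by metis
      then show ?thesis using y yz dir[OF zP False] by simp
    qed simp
    then show "y \<in> ?f ` ?A" using zP yz by blast
  qed
qed

text \<open>The scalars are renamed to naturals because \<open>desarguesian\<close> asks for a field
  on \<open>nat\<close>. The map \<open>\<kappa>\<close> goes from vectors to points, since it is
  the linear combination map of a basis.\<close>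

lemma exists_coordinates:
  obtains F :: "nat ring" and n \<kappa> where "field F" "finite (carrier F)" "2 \<le> n"
    "bij_betw \<kappa> (AG_points n F) P"
    "\<And>u v. \<lbrakk>u \<in> AG_points n F; v \<in> AG_points n F\<rbrakk> \<Longrightarrow> \<kappa> (\<lambda>i. u i \<oplus>\<^bsub>F\<^esub> v i) = \<kappa> u \<^bold>+ \<kappa> v"
    "\<And>d. \<lbrakk>d \<in> AG_points n F; d \<noteq> (\<lambda>i. \<zero>\<^bsub>F\<^esub>)\<rbrakk> \<Longrightarrow> \<kappa> d \<noteq> z0"
    "\<And>a d. \<lbrakk>a \<in> AG_points n F; d \<in> AG_points n F; d \<noteq> (\<lambda>i. \<zero>\<^bsub>F\<^esub>)\<rbrakk> \<Longrightarrow>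
      \<kappa> ` {(\<lambda>i. a i \<oplus>\<^bsub>F\<^esub> (t \<otimes>\<^bsub>F\<^esub> d i)) | t. t \<in> carrier F} =
      {y \<in> P. y = \<kappa> a \<or> dir (\<kappa> a) y = dir z0 (\<kappa> d)}"
proof -
  interpret D: field D by (rule field_D)
  obtain \<phi> :: "('a \<Rightarrow> 'a) \<Rightarrow> nat" where inj: "inj_on \<phi> (carrier D)"
    using finite_D by (metis finite_imp_inj_to_nat_seg)
  define F where "F = image_ring \<phi> D"
  define \<psi> where "\<psi> = inv_into (carrier D) \<phi>"
  have F: "field F" unfolding F_def by (rule D.inj_imp_image_ring_is_field[OF inj])
  interpret F: field F by (rule F)
  have car: "carrier F = \<phi> ` carrier D" by (simp add: F_def image_ring_carrier)
  then have finF: "finite (carrier F)" using finite_D by simp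
  have hom: "\<phi> \<in> ring_hom D F"
    using inj_imp_image_ring_iso[OF inj] by (simp add: F_def ring_iso_def)
  have \<psi>: "\<psi> t \<in> carrier D" "\<phi> (\<psi> t) = t" if "t \<in> carrier F" for t
    using that by (auto simp: \<psi>_def car inv_into_into f_inv_into_f)
  have \<psi>\<phi>: "\<psi> (\<phi> f) = f" if "f \<in> carrier D" for f
    using that inj by (simp add: \<psi>_def)
  have \<psi>_add: "\<psi> (s \<oplus>\<^bsub>F\<^esub> t) = \<psi> s \<oplus>\<^bsub>D\<^esub> \<psi> t" and \<psi>_mult: "\<psi> (s \<otimes>\<^bsub>F\<^esub> t) = \<psi> s \<otimes>\<^bsub>D\<^esub> \<psi> t"
    if "s \<in> carrier F" "t \<in> carrier F" for s t
    using ring_hom_add[OF hom \<psi>(1) \<psi>(1)] ring_hom_mult[OF hom \<psi>(1) \<psi>(1)] \<psi>(2) that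
      \<psi>\<phi>[OF D.a_closed[OF \<psi>(1) \<psi>(1)]] \<psi>\<phi>[OF D.m_closed[OF \<psi>(1) \<psi>(1)]] by metis+
  have \<psi>_one: "\<psi> \<one>\<^bsub>F\<^esub> = \<one>\<^bsub>D\<^esub>" using ring_hom_one[OF hom] \<psi>\<phi>[OF D.one_closed] by simp
  \<comment> \<open>The points form a vector space over the renamed field, on which \<open>t\<close>
    acts as the original scalar \<open>\<psi> t\<close>.\<close>
  define M :: "(nat, 'a) module" where "M = \<lparr>carrier = P, monoid.mult = undefined, one = undefined, zero = z0, add = (\<^bold>+),
    smult = (\<lambda>t x. \<psi> t x)\<rparr>"
  have M_simps: "carrier M = P" "\<zero>\<^bsub>M\<^esub> = z0" "\<And>x y. x \<oplus>\<^bsub>M\<^esub> y = x \<^bold>+ y" "\<And>t x. t \<odot>\<^bsub>M\<^esub> x = \<psi> t x"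
    by (simp_all add: M_def)
  have "module F M"
  proof (rule moduleI)
    show "cring F" ..
    show "abelian_group M"
    proof (rule abelian_groupI, unfold M_simps)
      show "x \<^bold>+ y \<^bold>+ z = x \<^bold>+ (y \<^bold>+ z)" if "x \<in> P" "y \<in> P" "z \<in> P" for x y z
        using that by (simp add: plus_assoc)
      show "\<exists>y\<in>P. y \<^bold>+ x = z0" if "x \<in> P" for x
        using that neg_closed plus_neg_left by blast
    qed (use plus_closed z0 plus_zero_left plus_commute in auto)
  qed (simp_all add: M_simps \<psi>_add \<psi>_mult \<psi>_one D_closed[OF \<psi>(1)] D_plus[OF \<psi>(1)])
  then interpret M: module F M .
  have finM: "finite (carrier M)" using finite_points by (simp add: M_simps)
  obtain n b where b: "\<And>i. b i \<in> carrier M" and bij: "bij_betw (lincomb M b n) (coords n F) (carrier M)"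
    using M.exists_basis[OF F finF finM] by blast
  define \<kappa> where "\<kappa> = lincomb M b n"
  have bij: "bij_betw \<kappa> (AG_points n F) P" using bij by (simp add: \<kappa>_def M_simps AG_points_eq_coords)
  have carF: "u i \<in> carrier F" if "u \<in> AG_points n F" for u i
    using that by (cases "i < n") (auto simp: AG_points_def)
  have \<kappa>_add: "\<kappa> (\<lambda>i. u i \<oplus>\<^bsub>F\<^esub> v i) = \<kappa> u \<^bold>+ \<kappa> v" if "u \<in> AG_points n F" "v \<in> AG_points n F" for u v
    unfolding \<kappa>_def M_simps(3)[symmetric] by (rule M.lincomb_add) (use b carF that in auto)
  have \<kappa>_smult: "\<kappa> (\<lambda>i. t \<otimes>\<^bsub>F\<^esub> v i) = \<psi> t (\<kappa> v)" if "t \<in> carrier F" "v \<in> AG_points n F" for t v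
    unfolding \<kappa>_def M_simps(4)[symmetric] by (rule M.lincomb_smult) (use b carF that in auto)
  have \<kappa>P: "\<kappa> u \<in> P" if "u \<in> AG_points n F" for u using bij that by (auto simp: bij_betw_def)
  have zeroAG: "(\<lambda>i. \<zero>\<^bsub>F\<^esub>) \<in> AG_points n F" by (simp add: AG_points_def)
  have \<kappa>0: "\<kappa> (\<lambda>i. \<zero>\<^bsub>F\<^esub>) = z0"
  proof -
    have "\<kappa> (\<lambda>i. \<zero>\<^bsub>F\<^esub>) \<^bold>+ \<kappa> (\<lambda>i. \<zero>\<^bsub>F\<^esub>) = \<kappa> (\<lambda>i. \<zero>\<^bsub>F\<^esub>) \<^bold>+ z0"
      using \<kappa>_add[OF zeroAG zeroAG] plus_zero_right[OF \<kappa>P[OF zeroAG]] by simp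
    then show ?thesis by (rule plus_left_cancel[OF \<kappa>P[OF zeroAG]])
  qed
  have nz: "\<kappa> d \<noteq> z0" if "d \<in> AG_points n F" "d \<noteq> (\<lambda>i. \<zero>\<^bsub>F\<^esub>)" for d
    using bij that zeroAG \<kappa>0 unfolding bij_betw_def inj_on_def by metis
  have smultAG: "(\<lambda>i. t \<otimes>\<^bsub>F\<^esub> d i) \<in> AG_points n F" if "t \<in> carrier F" "d \<in> AG_points n F" for t d
    using that by (simp add: AG_points_def)
  have line: "\<kappa> ` {(\<lambda>i. a i \<oplus>\<^bsub>F\<^esub> (t \<otimes>\<^bsub>F\<^esub> d i)) | t. t \<in> carrier F} =
      {y \<in> P. y = \<kappa> a \<or> dir (\<kappa> a) y = dir z0 (\<kappa> d)}"
    if a: "a \<in> AG_points n F" and d: "d \<in> AG_points n F" "d \<noteq> (\<lambda>i. \<zero>\<^bsub>F\<^esub>)" for a d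
  proof -
    have "\<kappa> (\<lambda>i. a i \<oplus>\<^bsub>F\<^esub> (t \<otimes>\<^bsub>F\<^esub> d i)) = \<kappa> a \<^bold>+ \<psi> t (\<kappa> d)" if "t \<in> carrier F" for t
      using \<kappa>_add[OF a smultAG[OF that d(1)]] \<kappa>_smult[OF that d(1)] by simp
    then have "\<kappa> ` {(\<lambda>i. a i \<oplus>\<^bsub>F\<^esub> (t \<otimes>\<^bsub>F\<^esub> d i)) | t. t \<in> carrier F}
        = (\<lambda>z. \<kappa> a \<^bold>+ z) ` {\<psi> t (\<kappa> d) | t. t \<in> carrier F}"
      by (auto simp: image_iff) metis+
    also have "{\<psi> t (\<kappa> d) | t. t \<in> carrier F} = {f (\<kappa> d) | f. f \<in> carrier D}"
    proof -
      have "\<psi> ` carrier F = carrier D" using \<psi> \<psi>\<phi> car by force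
      then have "carrier D = \<psi> ` carrier F" ..
      then show ?thesis by auto
    qed
    also have "\<dots> = {z \<in> P. z = z0 \<or> dir z0 z = dir z0 (\<kappa> d)}"
      using D_orbit \<kappa>P[OF d(1)] nz[OF d] by blast
    finally show ?thesis using line_as_translate[OF \<kappa>P[OF a] \<kappa>P[OF d(1)] nz[OF d]] by simp
  qed
  \<comment> \<open>Dimension 0 leaves only the origin, and in dimension 1 all points would lie on
    one line, contrary to \<open>dir_off\<close>.\<close>
  have "2 \<le> n"
  proof (rule ccontr)
    assume "\<not> 2 \<le> n"
    moreover have "n \<noteq> 0"
    proof
      assume "n = 0"
      then have "AG_points n F = {\<lambda>i. \<zero>\<^bsub>F\<^esub>}" by (auto simp: AG_points_def)
      then have "P = {z0}" using bij \<kappa>0 by (auto simp: bij_betw_def)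
      then show False using nontrivial by blast
    qed
    ultimately have n: "n = 1" by simp
    define d where "d = (\<lambda>i. if i = (0::nat) then \<one>\<^bsub>F\<^esub> else \<zero>\<^bsub>F\<^esub>)"
    have d: "d \<in> AG_points n F" "d \<noteq> (\<lambda>i. \<zero>\<^bsub>F\<^esub>)"
      by (auto simp: d_def AG_points_def n fun_eq_iff)
    have "u \<in> {(\<lambda>i. \<zero>\<^bsub>F\<^esub> \<oplus>\<^bsub>F\<^esub> (t \<otimes>\<^bsub>F\<^esub> d i)) | t. t \<in> carrier F}" if u: "u \<in> AG_points n F" for u
    proof (intro CollectI exI conjI)
      show "u 0 \<in> carrier F" using carF u by blast
      show "u = (\<lambda>i. \<zero>\<^bsub>F\<^esub> \<oplus>\<^bsub>F\<^esub> (u 0 \<otimes>\<^bsub>F\<^esub> d i))"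
        using u carF[OF u, of 0] by (auto simp: d_def AG_points_def n fun_eq_iff)
    qed
    then have "P \<subseteq> {y \<in> P. y = z0 \<or> dir z0 y = dir z0 (\<kappa> d)}"
      using line[OF zeroAG d] bij unfolding \<kappa>0 bij_betw_def by blast
    moreover obtain w where "w \<in> P" "w \<noteq> z0" "dir z0 w \<noteq> dir z0 (\<kappa> d)"
      using dir_off[OF z0 \<kappa>P[OF d(1)]] nz[OF d] by metis
    ultimately show False by blast
  qed
  from that[OF F finF this bij \<kappa>_add nz line] show thesis .
qed

end

section \<open>Affine spaces and their schemes\<close>

locale affine_space =
  fixes P :: "'a set" and L :: "'a set set" and par :: "'a set \<Rightarrow> 'a set \<Rightarrow> bool"
  assumes affine: "finite_affine_space P L par"
begin

lemma affine_unfolded: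
  shows finite_P: "finite P"
    and lines: "\<forall>l\<in>L. l \<subseteq> P \<and> 2 \<le> card l"
    and line_ex1_axiom: "\<forall>p\<in>P. \<forall>q\<in>P. p \<noteq> q \<longrightarrow> (\<exists>!l. l \<in> L \<and> p \<in> l \<and> q \<in> l)"
    and par_lines: "\<forall>l m. par l m \<longrightarrow> l \<in> L \<and> m \<in> L"
    and par_refl_axiom: "\<forall>l\<in>L. par l l"
    and par_sym_axiom: "\<forall>l m. par l m \<longrightarrow> par m l"
    and par_trans_axiom: "\<forall>l m k. par l m \<longrightarrow> par m k \<longrightarrow> par l k"
    and playfair_axiom: "\<forall>p\<in>P. \<forall>l\<in>L. \<exists>!m. m \<in> L \<and> p \<in> m \<and> par m l"
    and noncollinear: "\<exists>a\<in>P. \<exists>b\<in>P. \<exists>c\<in>P. a \<noteq> b \<and> a \<noteq> c \<and> b \<noteq> c \<and> \<not> collinear_pts L a b c"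
  by (insert affine, unfold finite_affine_space_def, (elim conjE, assumption)+)

lemmas line_ex1 = line_ex1_axiom[rule_format]
  and par_refl = par_refl_axiom[rule_format]
  and par_sym = par_sym_axiom[rule_format]
  and par_trans = par_trans_axiom[rule_format]
  and playfair = playfair_axiom[rule_format]

lemma line_subset: "l \<in> L \<Longrightarrow> l \<subseteq> P" and line_card: "l \<in> L \<Longrightarrow> 2 \<le> card l"
  using lines by blast+

lemma triangle:
  assumes "a \<in> P" "b \<in> P" "c \<in> P" "a' \<in> P" "b' \<in> P" "k \<in> L" "k' \<in> L" "lac \<in> L" "lbc \<in> L"
    "m1 \<in> L" "m2 \<in> L" "\<not> collinear_pts L a b c" "a' \<noteq> b'" "a \<in> k" "b \<in> k" "a' \<in> k'" "b' \<in> k'"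
    "par k k'" "a \<in> lac" "c \<in> lac" "b \<in> lbc" "c \<in> lbc" "a' \<in> m1" "par m1 lac" "b' \<in> m2" "par m2 lbc"
  shows "m1 \<inter> m2 \<noteq> {}"
  by (rule affine[unfolded finite_affine_space_def, THEN conjunct2, THEN conjunct2, THEN conjunct2,
        THEN conjunct2, THEN conjunct2, THEN conjunct2, THEN conjunct2, THEN conjunct2, THEN conjunct1,
        rule_format, OF assms(1-11)]) (intro conjI assms)

section \<open>Parallel classes as directions\<close>

definition ln :: "'a \<Rightarrow> 'a \<Rightarrow> 'a set" where
  "ln x y = (THE l. l \<in> L \<and> x \<in> l \<and> y \<in> l)"

text \<open>Representing a direction by the set of all lines of a parallel class turns parallelism
  into equality, as the abstract \<open>dir\<close> requires.\<close>

definition pdir :: "'a \<Rightarrow> 'a \<Rightarrow> 'a set set" where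
  "pdir x y = {m. par m (ln x y)}"

lemma ln:
  assumes "x \<in> P" "y \<in> P" "x \<noteq> y"
  shows ln_line: "ln x y \<in> L" and ln_left: "x \<in> ln x y" and ln_right: "y \<in> ln x y"
  using theI'[OF line_ex1[OF assms]] by (simp_all add: ln_def)

lemma ln_eqI: "\<lbrakk>l \<in> L; x \<in> l; y \<in> l; x \<noteq> y\<rbrakk> \<Longrightarrow> ln x y = l"
  using line_ex1[of x y] ln[of x y] line_subset[of l] by blast

lemma line_exists_points:
  assumes "l \<in> L" "x \<in> l" obtains y where "y \<in> l" "y \<noteq> x"
proof -
  have "\<not> l \<subseteq> {x}" using line_card[OF assms(1)] card_mono[of "{x}" l] by auto
  then show thesis using that by blast
qed

lemma line_as_ln:
  assumes "l \<in> L" obtains x y where "x \<in> P" "y \<in> P" "x \<noteq> y" "l = ln x y"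
proof -
  have "l \<noteq> {}" using line_card[OF assms] by auto
  then obtain x where x: "x \<in> l" by blast
  obtain y where y: "y \<in> l" "y \<noteq> x" using line_exists_points[OF assms x] .
  show thesis using that[of x y] x y line_subset[OF assms] ln_eqI[OF assms x y(1)] by blast
qed

text \<open>Both lines are the unique parallel to \<open>m\<close> through \<open>p\<close>.\<close>

lemma parallel_through_point: "\<lbrakk>par l m; p \<in> l; p \<in> m\<rbrakk> \<Longrightarrow> l = m"
  using playfair[of p m] par_lines[rule_format, of l m] line_subset par_refl[of m] by blast

lemma pdir_eq_iff:
  assumes "x \<in> P" "y \<in> P" "x \<noteq> y" "u \<in> P" "v \<in> P" "u \<noteq> v"
  shows "pdir x y = pdir u v \<longleftrightarrow> par (ln x y) (ln u v)"
proof
  assume "pdir x y = pdir u v"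
  then show "par (ln x y) (ln u v)"
    using par_refl[OF ln_line[OF assms(1-3)]] by (auto simp: pdir_def)
next
  assume "par (ln x y) (ln u v)"
  then show "pdir x y = pdir u v" using par_trans par_sym unfolding pdir_def by blast
qed

lemma ln_sym: "ln x y = ln y x"
  unfolding ln_def by (rule arg_cong[where f = The]) auto

lemma pdir_same_point:
  assumes "x \<in> P" "y \<in> P" "z \<in> P" "x \<noteq> y" "x \<noteq> z"
  shows "pdir x y = pdir x z \<longleftrightarrow> ln x y = ln x z"
  using assms pdir_eq_iff[of x y x z] parallel_through_point[of "ln x y" "ln x z" x]
    ln_left[of x y] ln_left[of x z] par_refl[OF ln_line[of x y]] by auto

text \<open>Lines are recovered from directions alone; this carries results about the abstract
  \<open>dir\<close> back to \<open>L\<close>.\<close>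

lemma ln_eq_pdir:
  assumes "x \<in> P" "y \<in> P" "x \<noteq> y"
  shows "ln x y = {z \<in> P. z = x \<or> pdir x z = pdir x y}"
proof (intro equalityI subsetI)
  fix z assume z: "z \<in> ln x y"
  have zP: "z \<in> P" using z line_subset[OF ln_line[OF assms]] by blast
  moreover have "pdir x z = pdir x y" if "z \<noteq> x"
    using ln_eqI[OF ln_line[OF assms] ln_left[OF assms] z] that
    by (simp add: pdir_def)
  ultimately show "z \<in> {z \<in> P. z = x \<or> pdir x z = pdir x y}" by blast
next
  fix z assume z: "z \<in> {z \<in> P. z = x \<or> pdir x z = pdir x y}"
  show "z \<in> ln x y"
  proof (cases "z = x")
    case True
    then show ?thesis using ln_left[OF assms] by simp
  next
    case False
    then have "ln x z = ln x y" using z pdir_same_point[of x z y] assms by auto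
    then show ?thesis using ln_right[of x z] z assms False by auto
  qed
qed

text \<open>The work lies in the triangle axiom: its line form yields a common point of
  \<open>m1\<close> and \<open>m2\<close>, but that this point differs from a' and b' has to be
  added.\<close>

sublocale affine_directions P pdir
proof
  show "finite P" by (rule finite_P)
  show "pdir x y = pdir y x" for x y by (simp add: pdir_def ln_sym[of x y])
  show "pdir y z = pdir x y"
    if P: "x \<in> P" "y \<in> P" "z \<in> P" "x \<noteq> y" "x \<noteq> z" "y \<noteq> z" and eq: "pdir x y = pdir x z" for x y z
  proof -
    have "ln x y = ln x z" using pdir_same_point P eq by blast
    then have "ln y z = ln x y"
      using ln_eqI[of "ln x y" y z] ln_line[of x y] ln_right[of x y] ln_right[of x z] P by auto
    then show ?thesis by (simp add: pdir_def)
  qed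
  show "\<exists>z\<in>P. z \<noteq> p \<and> pdir p z = pdir x y"
    if P: "x \<in> P" "y \<in> P" "x \<noteq> y" "p \<in> P" for x y p
  proof -
    obtain m where m: "m \<in> L" "p \<in> m" "par m (ln x y)"
      using playfair[OF P(4) ln_line[OF P(1-3)]] by blast
    obtain z where z: "z \<in> m" "z \<noteq> p" using line_exists_points[OF m(1,2)] .
    have "z \<in> P" "ln p z = m" using z m line_subset ln_eqI by auto
    then show ?thesis using pdir_eq_iff[of p z x y] P m z by auto
  qed
  show "\<exists>c'\<in>P. c' \<noteq> a' \<and> c' \<noteq> b' \<and> pdir a' c' = pdir a c \<and> pdir b' c' = pdir b c"
    if P: "a \<in> P" "b \<in> P" "c \<in> P" "a' \<in> P" "b' \<in> P" and neq: "a \<noteq> b" "a \<noteq> c" "b \<noteq> c" "a' \<noteq> b'"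
      and d: "pdir a b \<noteq> pdir a c" "pdir a b = pdir a' b'" for a b c a' b'
  proof -
    have ncol: "\<not> collinear_pts L a b c"
    proof
      assume "collinear_pts L a b c"
      then obtain l where "l \<in> L" "a \<in> l" "b \<in> l" "c \<in> l" by (auto simp: collinear_pts_def)
      then have "ln a b = ln a c" using ln_eqI[of l a b] ln_eqI[of l a c] neq by simp
      then show False using d(1) by (simp add: pdir_def)
    qed
    have pab: "par (ln a b) (ln a' b')" using pdir_eq_iff[of a b a' b'] P neq d by simp
    have "ln a b \<noteq> ln a c" using d(1) by (auto simp: pdir_def)
    have lb: "ln b c \<noteq> ln a b"
    proof
      assume eq: "ln b c = ln a b"
      then have "c \<in> ln a b" using ln_right[of b c] P neq by simp
      then have "ln a c = ln a b" using ln_eqI[OF ln_line ln_left, of a b c] P neq by simp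
      with \<open>ln a b \<noteq> ln a c\<close> show False by simp
    qed
    obtain m1 where m1: "m1 \<in> L" "a' \<in> m1" "par m1 (ln a c)"
      using playfair[of a' "ln a c"] ln_line[of a c] P neq by blast
    obtain m2 where m2: "m2 \<in> L" "b' \<in> m2" "par m2 (ln b c)"
      using playfair[of b' "ln b c"] ln_line[of b c] P neq by blast
    have "m1 \<inter> m2 \<noteq> {}"
      by (rule triangle[of a b c a' b' "ln a b" "ln a' b'" "ln a c" "ln b c"])
        (use P neq m1 m2 pab ncol ln in auto)
    then obtain c' where c': "c' \<in> m1" "c' \<in> m2" by blast
    have c'P: "c' \<in> P" using c' m1 line_subset by blast
    \<comment> \<open>Otherwise \<open>m2\<close> is the line a'b', so bc is parallel to ab and
      equal to it because both pass through \<open>b\<close>.\<close>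
    have "c' \<noteq> a'"
    proof
      assume "c' = a'"
      then have "ln a' b' = m2" using ln_eqI[of m2 a' b'] m2 c' neq by simp
      then have "par (ln a b) (ln b c)" using pab m2 par_trans by blast
      then have "ln a b = ln b c"
        using parallel_through_point[of "ln a b" "ln b c" b] ln_right[of a b] ln_left[of b c] P neq by blast
      with lb show False by simp
    qed
    moreover have "c' \<noteq> b'"
    proof
      assume "c' = b'"
      then have "ln a' b' = m1" using ln_eqI[of m1 a' b'] m1 c' neq by simp
      then have "par (ln a b) (ln a c)" using pab m1 par_trans by blast
      then have "ln a b = ln a c"
        using parallel_through_point[of "ln a b" "ln a c" a] ln_left[of a b] ln_left[of a c] P neq by blast
      with \<open>ln a b \<noteq> ln a c\<close> show False by simp
    qed
    moreover have "pdir a' c' = pdir a c"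
      using pdir_eq_iff[of a' c' a c] ln_eqI[of m1 a' c'] m1 c' c'P P neq \<open>c' \<noteq> a'\<close> by auto
    moreover have "pdir b' c' = pdir b c"
      using pdir_eq_iff[of b' c' b c] ln_eqI[of m2 b' c'] m2 c' c'P P neq \<open>c' \<noteq> b'\<close> by auto
    ultimately show ?thesis using c'P by blast
  qed
  show "\<exists>w\<in>P. w \<noteq> x \<and> w \<noteq> y \<and> pdir x w \<noteq> pdir x y" if P: "x \<in> P" "y \<in> P" "x \<noteq> y" for x y
  proof -
    \<comment> \<open>The line xy cannot contain three non-collinear points, so one of them lies off
      it.\<close>
    obtain a b c where "a \<in> P" "b \<in> P" "c \<in> P" "\<not> collinear_pts L a b c" using noncollinear by blast
    then obtain w where "w \<in> P" "w \<notin> ln x y"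
      using ln_line[OF P] unfolding collinear_pts_def by blast
    then show ?thesis using ln_eq_pdir[OF P] ln_right[OF P] by blast
  qed
qed

section \<open>The scheme as a set of direction classes\<close>

definition dir_class :: "'a \<Rightarrow> 'a \<Rightarrow> ('a \<times> 'a) set" where
  "dir_class u v = {(x, y). x \<in> P \<and> y \<in> P \<and> x \<noteq> y \<and> pdir x y = pdir u v}"

lemma dir_rel_ln:
  assumes "u \<in> P" "v \<in> P" "u \<noteq> v"
  shows "dir_rel P L par (ln u v) = dir_class u v"
proof -
  have "(\<exists>l\<in>L. x \<in> l \<and> y \<in> l \<and> par l (ln u v)) \<longleftrightarrow> pdir x y = pdir u v"
    if P: "x \<in> P" "y \<in> P" "x \<noteq> y" for x y
    unfolding pdir_eq_iff[OF P assms]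
  proof
    assume "\<exists>l\<in>L. x \<in> l \<and> y \<in> l \<and> par l (ln u v)"
    then obtain l where "l \<in> L" "x \<in> l" "y \<in> l" "par l (ln u v)" by blast
    then show "par (ln x y) (ln u v)" using ln_eqI[of l x y] P(3) by simp
  next
    assume "par (ln x y) (ln u v)"
    then show "\<exists>l\<in>L. x \<in> l \<and> y \<in> l \<and> par l (ln u v)" using ln[OF P] by blast
  qed
  then show ?thesis unfolding dir_rel_def dir_class_def by auto
qed

lemma affine_scheme_eq:
  "affine_scheme P L par = insert (Id_on P) {dir_class u v | u v. u \<in> P \<and> v \<in> P \<and> u \<noteq> v}"
proof -
  have "dir_rel P L par ` L = {dir_class u v | u v. u \<in> P \<and> v \<in> P \<and> u \<noteq> v}"
  proof (intro equalityI subsetI)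
    fix r assume "r \<in> dir_rel P L par ` L"
    then obtain l where l: "l \<in> L" "r = dir_rel P L par l" by blast
    obtain u v where uv: "u \<in> P" "v \<in> P" "u \<noteq> v" "l = ln u v" using line_as_ln[OF l(1)] .
    then show "r \<in> {dir_class u v | u v. u \<in> P \<and> v \<in> P \<and> u \<noteq> v}"
      using dir_rel_ln[of u v] l(2) by blast
  next
    fix r assume "r \<in> {dir_class u v | u v. u \<in> P \<and> v \<in> P \<and> u \<noteq> v}"
    then obtain u v where uv: "u \<in> P" "v \<in> P" "u \<noteq> v" "r = dir_class u v" by blast
    then show "r \<in> dir_rel P L par ` L"
      using dir_rel_ln[of u v] ln_line[of u v] by (intro image_eqI[of _ _ "ln u v"]) auto
  qed
  then show ?thesis unfolding affine_scheme_def by simp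
qed

text \<open>The orbit of a pair is a member of the scheme that contains this pair, and a direction
  class is determined by any of its pairs. In the converse the diagonal needs an argument:
  transitivity on points is drawn from that on pairs.\<close>

lemma scheme_eq_orbits_iff:
  assumes G: "perm_group_on P G"
  shows "affine_scheme P L par = pair_orbit G ` (P \<times> P) \<longleftrightarrow>
    (\<forall>x\<in>P. \<forall>y\<in>P. x \<noteq> y \<longrightarrow> pair_orbit G (x, y) = dir_class x y)" (is "?lhs \<longleftrightarrow> ?rhs")
proof
  assume L: ?lhs
  show ?rhs
  proof (intro ballI impI)
    fix x y assume P: "x \<in> P" "y \<in> P" "x \<noteq> y"
    have "id \<in> G" using G by (simp add: perm_group_on_def)
    then have xy: "(x, y) \<in> pair_orbit G (x, y)" unfolding pair_orbit_def by (intro CollectI exI[of _ id]) simp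
    have "pair_orbit G (x, y) \<in> affine_scheme P L par" using L P by simp
    then consider "pair_orbit G (x, y) = Id_on P" | u v where "pair_orbit G (x, y) = dir_class u v"
      unfolding affine_scheme_eq by blast
    then show "pair_orbit G (x, y) = dir_class x y"
    proof cases
      case 1
      then show ?thesis using xy P by auto
    next
      case 2
      then have "pdir x y = pdir u v" using xy by (simp add: dir_class_def)
      then show ?thesis using 2 by (simp add: dir_class_def)
    qed
  qed
next
  assume R: ?rhs
  have maps: "g x \<in> P" if "g \<in> G" "x \<in> P" for g x
  proof -
    have "g permutes P" using G that(1) unfolding perm_group_on_def by blast
    then show ?thesis using that(2) by (simp add: permutes_in_image)
  qed
  obtain a b where ab: "a \<in> P" "b \<in> P" "a \<noteq> b" using noncollinear by blast
  have id: "id \<in> G" using G by (simp add: perm_group_on_def)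
  have diag: "pair_orbit G (x, x) = Id_on P" if x: "x \<in> P" for x
  proof (intro equalityI subsetI)
    fix r assume "r \<in> pair_orbit G (x, x)"
    then show "r \<in> Id_on P" using maps x by (auto simp: pair_orbit_def)
  next
    fix r assume "r \<in> Id_on P"
    then obtain p where p: "p \<in> P" "r = (p, p)" by (auto elim: Id_onE)
    obtain y where y: "y \<in> P" "y \<noteq> x" using ab by metis
    \<comment> \<open>A pair that starts at \<open>p\<close> and has the direction of (x, y) lies in
      the orbit of (x, y), so some element takes \<open>x\<close> to \<open>p\<close>.\<close>
    obtain z where z: "z \<in> P" "z \<noteq> p" "pdir p z = pdir x y" using dir_exists[OF x y(1) _ p(1)] y(2) by metis
    then have "(p, z) \<in> pair_orbit G (x, y)"
      using R x y p by (auto simp: dir_class_def)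
    then show "r \<in> pair_orbit G (x, x)" using p by (auto simp: pair_orbit_def)
  qed
  show ?lhs unfolding affine_scheme_eq
  proof (intro equalityI subsetI)
    fix r assume "r \<in> insert (Id_on P) {dir_class u v | u v. u \<in> P \<and> v \<in> P \<and> u \<noteq> v}"
    then consider "r = Id_on P" | u v where "u \<in> P" "v \<in> P" "u \<noteq> v" "r = dir_class u v" by blast
    then show "r \<in> pair_orbit G ` (P \<times> P)"
    proof cases
      case 1
      then show ?thesis using diag[OF ab(1)] ab(1) by (intro image_eqI[of _ _ "(a, a)"]) auto
    next
      case 2
      then show ?thesis using R by (intro image_eqI[of _ _ "(u, v)"]) auto
    qed
  next
    fix r assume "r \<in> pair_orbit G ` (P \<times> P)"
    then obtain x y where "x \<in> P" "y \<in> P" "r = pair_orbit G (x, y)" by auto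
    then show "r \<in> insert (Id_on P) {dir_class u v | u v. u \<in> P \<and> v \<in> P \<and> u \<noteq> v}"
      using diag R by (cases "x = y") auto
  qed
qed

lemma dilatation_groupI:
  assumes G: "perm_group_on P G" and scheme: "affine_scheme P L par = pair_orbit G ` (P \<times> P)"
  shows "dilatation_group P pdir G"
proof unfold_locales
  have orbit: "pair_orbit G (x, y) = dir_class x y" if "x \<in> P" "y \<in> P" "x \<noteq> y" for x y
    using scheme_eq_orbits_iff[OF G] scheme that by blast
  show "perm_group_on P G" by fact
  show "pdir (g x) (g y) = pdir x y" if "g \<in> G" "x \<in> P" "y \<in> P" "x \<noteq> y" for g x y
  proof -
    have "(g x, g y) \<in> pair_orbit G (x, y)" using that(1) by (auto simp: pair_orbit_def)
    then show ?thesis using orbit[OF that(2-4)] by (simp add: dir_class_def)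
  qed
  show "\<exists>g\<in>G. g x = u \<and> g y = v"
    if "x \<in> P" "y \<in> P" "u \<in> P" "v \<in> P" "x \<noteq> y" "u \<noteq> v" "pdir x y = pdir u v" for x y u v
  proof -
    have "(u, v) \<in> pair_orbit G (x, y)" using orbit[of x y] that by (simp add: dir_class_def)
    then show ?thesis by (auto simp: pair_orbit_def)
  qed
qed

end

section \<open>From a schurian scheme to coordinates\<close>

text \<open>A line is described by a point and a direction through \<open>ln_eq_pdir\<close>, and
  \<open>g\<close> respects both. Applied to translations, this compares \<open>par\<close> with
  \<open>AG_par\<close>, which is defined by translates.\<close>

lemma (in affine_space) dilatation_image_line:
  assumes "dilatation_group P pdir G" and g: "g \<in> G" and l: "l \<in> L"
  shows "g ` l \<in> L" "par l (g ` l)"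
proof -
  interpret dilatation_group P pdir G by fact
  obtain x y where xy: "x \<in> P" "y \<in> P" "x \<noteq> y" "l = ln x y" using line_as_ln[OF l] .
  have gxy: "g x \<in> P" "g y \<in> P" "g x \<noteq> g y" using maps[OF g] inj[OF g] xy by auto
  have mem: "g z \<in> ln (g x) (g y) \<longleftrightarrow> z \<in> ln x y" if z: "z \<in> P" for z
  proof (cases "z = x")
    case True
    then show ?thesis using ln_left[OF xy(1-3)] ln_left[OF gxy] by simp
  next
    case False
    then have "g z \<noteq> g x" using inj[OF g] by blast
    then show ?thesis unfolding ln_eq_pdir[OF xy(1-3)] ln_eq_pdir[OF gxy]
      using dilatation[OF g xy(1-3)] dilatation[OF g xy(1) z] False z maps[OF g z] by simp
  qed
  have "g ` l = ln (g x) (g y)"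
  proof (intro equalityI subsetI)
    fix w assume "w \<in> g ` l"
    then show "w \<in> ln (g x) (g y)" using mem line_subset[OF l] xy(4) by auto
  next
    fix w assume w: "w \<in> ln (g x) (g y)"
    then have "w \<in> P" using line_subset[OF ln_line[OF gxy]] by blast
    then have P: "Hilbert_Choice.inv g w \<in> P" using maps[OF inv_in[OF g]] by blast
    then have "Hilbert_Choice.inv g w \<in> l" using mem[OF P] w inv_apply(2)[OF g] xy(4) by simp
    then show "w \<in> g ` l" using inv_apply(2)[OF g, of w] by (metis imageI)
  qed
  then show "g ` l \<in> L" "par l (g ` l)"
    using ln_line[OF gxy] pdir_eq_iff[OF xy(1-3) gxy] dilatation[OF g xy(1-3)] xy(4) by simp_all
qed

text \<open>\<open>affine_iso\<close> asks for a map out of the affine space, whereas the coordinate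
  map starts from the vectors.\<close>

lemma affine_isoI_inverse:
  assumes bij: "bij_betw \<kappa> P' P" and sub: "\<And>l. l \<in> L' \<Longrightarrow> l \<subseteq> P'"
    and lines: "(\<lambda>l. \<kappa> ` l) ` L' = L"
    and par: "\<And>l m. \<lbrakk>l \<in> L'; m \<in> L'\<rbrakk> \<Longrightarrow> par (\<kappa> ` l) (\<kappa> ` m) \<longleftrightarrow> par' l m"
  shows "affine_iso P L par P' L' par'"
  unfolding affine_iso_def
proof (intro exI conjI ballI)
  let ?f = "inv_into P' \<kappa>"
  show "bij_betw ?f P P'" using bij by (rule bij_betw_inv_into)
  have inv: "?f ` (\<kappa> ` l) = l" if "l \<in> L'" for l
    using bij sub[OF that] by (auto simp: bij_betw_def inv_into_image_cancel)
  show "(\<lambda>l. ?f ` l) ` L = L'"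
  proof -
    have "(\<lambda>l. ?f ` l) ` L = (\<lambda>l. ?f ` (\<kappa> ` l)) ` L'" unfolding lines[symmetric] by (rule image_image)
    also have "\<dots> = (\<lambda>l. l) ` L'" by (rule image_cong[OF refl inv])
    finally show ?thesis by simp
  qed
  fix l m assume "l \<in> L" "m \<in> L"
  then obtain l' m' where "l' \<in> L'" "m' \<in> L'" "l = \<kappa> ` l'" "m = \<kappa> ` m'" using lines by blast
  then show "par l m \<longleftrightarrow> par' (?f ` l) (?f ` m)" using par inv by simp
qed

lemma AG_lines_subset: 
  assumes "ring F" "l \<in> AG_lines n F" shows "l \<subseteq> AG_points n F"
proof -
  interpret ring F by fact
  show ?thesis using assms(2) by (auto simp: AG_lines_def AG_points_def)
qed

lemma (in affine_space) schurian_imp_desarguesian: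
  assumes "schurian P (affine_scheme P L par)"
  shows "desarguesian P L par"
proof -
  obtain G where G: "perm_group_on P G" "affine_scheme P L par = pair_orbit G ` (P \<times> P)"
    using assms unfolding schurian_def by blast
  have dil: "dilatation_group P pdir G" using dilatation_groupI[OF G] .
  obtain z0 where z0: "z0 \<in> P" "\<exists>w\<in>P. w \<noteq> z0" using noncollinear by metis
  interpret pointed_dilatation_group P pdir G z0
    using dil z0 by (simp add: pointed_dilatation_group_def pointed_dilatation_group_axioms_def)
  show ?thesis
  proof (rule exists_coordinates)
    fix F :: "nat ring" and n \<kappa>
    assume F: "field F" "finite (carrier F)" "2 \<le> n"
      and bij: "bij_betw \<kappa> (AG_points n F) P"
      and add: "\<And>u v. \<lbrakk>u \<in> AG_points n F; v \<in> AG_points n F\<rbrakk> \<Longrightarrow> \<kappa> (\<lambda>i. u i \<oplus>\<^bsub>F\<^esub> v i) = padd (\<kappa> u) (\<kappa> v)"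
      and nz: "\<And>d. \<lbrakk>d \<in> AG_points n F; d \<noteq> (\<lambda>i. \<zero>\<^bsub>F\<^esub>)\<rbrakk> \<Longrightarrow> \<kappa> d \<noteq> z0"
      and line: "\<And>a d. \<lbrakk>a \<in> AG_points n F; d \<in> AG_points n F; d \<noteq> (\<lambda>i. \<zero>\<^bsub>F\<^esub>)\<rbrakk> \<Longrightarrow>
        \<kappa> ` {(\<lambda>i. a i \<oplus>\<^bsub>F\<^esub> (t \<otimes>\<^bsub>F\<^esub> d i)) | t. t \<in> carrier F} =
        {y \<in> P. y = \<kappa> a \<or> pdir (\<kappa> a) y = pdir z0 (\<kappa> d)}"
    interpret F: field F by fact
    have \<kappa>P: "\<kappa> u \<in> P" if "u \<in> AG_points n F" for u using bij that by (auto simp: bij_betw_def)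
    have sub: "l \<subseteq> AG_points n F" if "l \<in> AG_lines n F" for l using AG_lines_subset[OF F.ring_axioms that] .
    have line_ln: "{y \<in> P. y = x \<or> pdir x y = pdir z0 w} = ln x (padd x w)" "padd x w \<in> P" "x \<noteq> padd x w"
      if x: "x \<in> P" and w: "w \<in> P" "w \<noteq> z0" for x w
    proof -
      show P: "padd x w \<in> P" using plus_closed x w by blast
      show neq: "x \<noteq> padd x w" using plus_left_cancel[OF x, of z0 w] plus_zero_right[OF x] w by metis
      have "pdir x (padd x w) = pdir z0 w"
        using dir_plus[OF x z0(1) w(1)] w plus_zero_right[OF x] by simp
      then show "{y \<in> P. y = x \<or> pdir x y = pdir z0 w} = ln x (padd x w)"
        using ln_eq_pdir[OF x P neq] by simp
    qed
    have lines: "(\<lambda>l. \<kappa> ` l) ` AG_lines n F = L"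
    proof (intro equalityI subsetI)
      fix l assume "l \<in> (\<lambda>l. \<kappa> ` l) ` AG_lines n F"
      then obtain a d where ad: "a \<in> AG_points n F" "d \<in> AG_points n F" "d \<noteq> (\<lambda>i. \<zero>\<^bsub>F\<^esub>)"
        and l: "l = \<kappa> ` {(\<lambda>i. a i \<oplus>\<^bsub>F\<^esub> (t \<otimes>\<^bsub>F\<^esub> d i)) | t. t \<in> carrier F}"
        unfolding AG_lines_def by blast
      note w = \<kappa>P[OF ad(1)] \<kappa>P[OF ad(2)] nz[OF ad(2,3)]
      have "l = ln (\<kappa> a) (padd (\<kappa> a) (\<kappa> d))" unfolding l line[OF ad] line_ln(1)[OF w] ..
      then show "l \<in> L" using ln_line[OF w(1) line_ln(2,3)[OF w]] by simp
    next
      fix l assume l: "l \<in> L"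
      obtain x y where xy: "x \<in> P" "y \<in> P" "x \<noteq> y" "l = ln x y" using line_as_ln[OF l] .
      \<comment> \<open>The difference y - x, a direction vector of the line.\<close>
      define w where "w = padd (neg x) y"
      have wP: "w \<in> P" using xy by (simp add: w_def neg_closed plus_closed)
      have yw: "padd x w = y"
        using plus_assoc[OF xy(1) neg_closed[OF xy(1)], of y] plus_neg[OF xy(1)] plus_zero_left[OF xy(2)]
        by (simp add: w_def)
      then have w0: "w \<noteq> z0" using plus_zero_right[OF xy(1)] xy(3) by metis
      obtain a d where ad: "a \<in> AG_points n F" "\<kappa> a = x" "d \<in> AG_points n F" "\<kappa> d = w"
        using bij xy(1) wP unfolding bij_betw_def by blast
      have zeroAG: "(\<lambda>i. \<zero>\<^bsub>F\<^esub>) \<in> AG_points n F" by (simp add: AG_points_def)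
      \<comment> \<open>By surjectivity some vector is sent to the origin, and by \<open>nz\<close>
        it can only be the zero vector.\<close>
      obtain e where "e \<in> AG_points n F" "\<kappa> e = z0" using bij z0(1) unfolding bij_betw_def by blast
      then have "\<kappa> (\<lambda>i. \<zero>\<^bsub>F\<^esub>) = z0" using nz by metis
      then have d0: "d \<noteq> (\<lambda>i. \<zero>\<^bsub>F\<^esub>)" using ad(4) w0 by metis
      have "l = \<kappa> ` {(\<lambda>i. a i \<oplus>\<^bsub>F\<^esub> (t \<otimes>\<^bsub>F\<^esub> d i)) | t. t \<in> carrier F}"
        unfolding line[OF ad(1,3) d0] ad(2,4) line_ln(1)[OF xy(1) wP w0] yw xy(4) ..
      moreover have "{(\<lambda>i. a i \<oplus>\<^bsub>F\<^esub> (t \<otimes>\<^bsub>F\<^esub> d i)) | t. t \<in> carrier F} \<in> AG_lines n F"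
        unfolding AG_lines_def using ad(1,3) d0 by blast
      ultimately show "l \<in> (\<lambda>l. \<kappa> ` l) ` AG_lines n F" by blast
    qed
    have shift: "\<kappa> ` ((\<lambda>x i. x i \<oplus>\<^bsub>F\<^esub> v i) ` l) = tr (\<kappa> v) ` (\<kappa> ` l)"
      if l: "l \<subseteq> AG_points n F" and v: "v \<in> AG_points n F" for l v
      unfolding image_image
    proof (rule image_cong[OF refl])
      fix x assume "x \<in> l"
      then have x: "x \<in> AG_points n F" using l by blast
      show "\<kappa> (\<lambda>i. x i \<oplus>\<^bsub>F\<^esub> v i) = tr (\<kappa> v) (\<kappa> x)"
        using add[OF x v] plus_commute[OF \<kappa>P[OF x] \<kappa>P[OF v]] by (simp add: padd_def)
    qed
    have par: "par (\<kappa> ` l) (\<kappa> ` m) \<longleftrightarrow> AG_par n F l m" if l: "l \<in> AG_lines n F" and m: "m \<in> AG_lines n F" for l m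
    proof
      have lL: "\<kappa> ` l \<in> L" and mL: "\<kappa> ` m \<in> L" using l m lines by blast+
      {
        assume "AG_par n F l m"
        then obtain v where v: "v \<in> AG_points n F" "m = (\<lambda>x i. x i \<oplus>\<^bsub>F\<^esub> v i) ` l"
          unfolding AG_par_def by blast
        then have "\<kappa> ` m = tr (\<kappa> v) ` (\<kappa> ` l)" using shift[OF sub[OF l] v(1)] by simp
        then show "par (\<kappa> ` l) (\<kappa> ` m)"
          using dilatation_image_line(2)[OF dil T_G[OF tr_T[OF \<kappa>P[OF v(1)]]] lL] by simp
      next
        assume p: "par (\<kappa> ` l) (\<kappa> ` m)"
        obtain x where x: "x \<in> \<kappa> ` l" using line_card[OF lL] by fastforce
        obtain u where u: "u \<in> \<kappa> ` m" using line_card[OF mL] by fastforce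
        have xu: "x \<in> P" "u \<in> P" using x u line_subset lL mL by blast+
        \<comment> \<open>The translation taking a point of the first line to a point of the second
          maps the first line to a parallel through that point, which must be the second
          line.\<close>
        obtain \<sigma> where \<sigma>: "\<sigma> \<in> T" "\<sigma> x = u" using T_exists[OF xu] by blast
        note img = dilatation_image_line[OF dil T_G[OF \<sigma>(1)] lL]
        have "par (\<kappa> ` m) (\<sigma> ` \<kappa> ` l)" using par_trans[OF par_sym[OF p] img(2)] .
        moreover have "u \<in> \<sigma> ` \<kappa> ` l" using x \<sigma>(2) by blast
        ultimately have eq: "\<kappa> ` m = \<sigma> ` \<kappa> ` l" using parallel_through_point u by blast
        have "\<sigma> z0 \<in> P" using maps[OF T_G[OF \<sigma>(1)] z0(1)] .
        then obtain v where v: "v \<in> AG_points n F" "\<kappa> v = \<sigma> z0"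
          using bij unfolding bij_betw_def by (metis imageE)
        have "tr (\<kappa> v) = \<sigma>" using tr_eqI[OF \<sigma>(1)] v(2) by simp
        then have shifted: "\<kappa> ` m = \<kappa> ` ((\<lambda>x i. x i \<oplus>\<^bsub>F\<^esub> v i) ` l)"
          using eq shift[OF sub[OF l] v(1)] by simp
        have "(\<lambda>x i. x i \<oplus>\<^bsub>F\<^esub> v i) ` l \<subseteq> AG_points n F"
          using sub[OF l] v(1) by (auto simp: AG_points_def)
        from inj_on_image_eq_iff[OF bij_betw_imp_inj_on[OF bij] sub[OF m] this]
        have "m = (\<lambda>x i. x i \<oplus>\<^bsub>F\<^esub> v i) ` l" using shifted by (rule iffD1)
        then show "AG_par n F l m" unfolding AG_par_def using l m v(1) by blast
      }
    qed
    have "affine_iso P L par (AG_points n F) (AG_lines n F) (AG_par n F)"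
      using bij sub lines par by (rule affine_isoI_inverse)
    then show "desarguesian P L par" unfolding desarguesian_def using F by blast
  qed
qed

section \<open>From coordinates to a transitive group of dilatations\<close>

lemma AG_points_carrier: "\<lbrakk>ring F; u \<in> AG_points n F\<rbrakk> \<Longrightarrow> u i \<in> carrier F"
  using ring.ring_simprules(2)[of F] by (cases "i < n") (auto simp: AG_points_def)

context affine_space
begin

text \<open>The largest candidate for the group: its orbits on pairs always lie inside the direction
  classes, so coordinates are needed for transitivity only.\<close>

definition dilatations :: "('a \<Rightarrow> 'a) set" where
  "dilatations = {g. g permutes P \<and> (\<forall>x\<in>P. \<forall>y\<in>P. x \<noteq> y \<longrightarrow> pdir (g x) (g y) = pdir x y)}"

lemma perm_group_dilatations: "perm_group_on P dilatations"
  unfolding perm_group_on_def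
proof (intro conjI ballI)
  show "id \<in> dilatations" by (simp add: dilatations_def permutes_id)
  show "g permutes P" if "g \<in> dilatations" for g using that by (simp add: dilatations_def)
  fix g assume g: "g \<in> dilatations"
  then have gp: "g permutes P" by (simp add: dilatations_def)
  have gd: "pdir (g x) (g y) = pdir x y" if "x \<in> P" "y \<in> P" "x \<noteq> y" for x y
    using g that unfolding dilatations_def by blast
  show "g \<circ> h \<in> dilatations" if h: "h \<in> dilatations" for h
  proof -
    have hp: "h permutes P" using h by (simp add: dilatations_def)
    have "pdir (g (h x)) (g (h y)) = pdir x y" if "x \<in> P" "y \<in> P" "x \<noteq> y" for x y
    proof -
      have "h x \<in> P" "h y \<in> P" using permutes_in_image[OF hp] that by auto
      moreover have "h x \<noteq> h y" using permutes_inj[OF hp] that by (auto dest: injD)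
      moreover have "pdir (h x) (h y) = pdir x y" using h that unfolding dilatations_def by blast
      ultimately show ?thesis using gd[of "h x" "h y"] by simp
    qed
    then show ?thesis using permutes_compose[OF hp gp] by (simp add: dilatations_def)
  qed
  have "pdir (Hilbert_Choice.inv g x) (Hilbert_Choice.inv g y) = pdir x y"
    if "x \<in> P" "y \<in> P" "x \<noteq> y" for x y
  proof -
    let ?x = "Hilbert_Choice.inv g x" and ?y = "Hilbert_Choice.inv g y"
    have e: "g ?x = x" "g ?y = y" using permutes_inverses(1)[OF gp] by auto
    have P: "?x \<in> P" "?y \<in> P" using permutes_in_image[OF permutes_inv[OF gp]] that by auto
    have "?x \<noteq> ?y" using e that(3) by metis
    then show ?thesis using gd[OF P] e by simp
  qed
  then have "Hilbert_Choice.inv g \<in> dilatations" using permutes_inv[OF gp] by (simp add: dilatations_def)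
  moreover have "g \<circ> Hilbert_Choice.inv g = id" using permutes_inv_o(1)[OF gp] .
  ultimately show "\<exists>h\<in>dilatations. g \<circ> h = id" by blast
qed

lemma orbit_dilatations:
  assumes P: "x \<in> P" "y \<in> P" "x \<noteq> y"
    and trans: "\<And>u v. \<lbrakk>u \<in> P; v \<in> P; u \<noteq> v; pdir u v = pdir x y\<rbrakk> \<Longrightarrow> \<exists>g\<in>dilatations. g x = u \<and> g y = v"
  shows "pair_orbit dilatations (x, y) = dir_class x y"
proof (intro equalityI subsetI)
  fix r assume "r \<in> pair_orbit dilatations (x, y)"
  then obtain g where g: "g \<in> dilatations" "r = (g x, g y)" by (auto simp: pair_orbit_def)
  then have gp: "g permutes P" by (simp add: dilatations_def)
  have "g x \<in> P" "g y \<in> P" using permutes_in_image[OF gp] P by auto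
  moreover have "g x \<noteq> g y" using permutes_inj[OF gp] P by (auto dest: injD)
  moreover have "pdir (g x) (g y) = pdir x y" using g P unfolding dilatations_def by blast
  ultimately show "r \<in> dir_class x y" using g by (simp add: dir_class_def)
next
  fix r assume "r \<in> dir_class x y"
  then obtain u v where uv: "u \<in> P" "v \<in> P" "u \<noteq> v" "pdir u v = pdir x y" "r = (u, v)"
    by (auto simp: dir_class_def)
  then obtain g where "g \<in> dilatations" "g x = u" "g y = v" using trans by blast
  then show "r \<in> pair_orbit dilatations (x, y)" using uv(5) by (auto simp: pair_orbit_def)
qed

lemma desarguesian_imp_schurian:
  assumes "desarguesian P L par"
  shows "schurian P (affine_scheme P L par)"
proof -
  obtain F :: "nat ring" and n where F: "field F" "finite (carrier F)"
    and iso: "affine_iso P L par (AG_points n F) (AG_lines n F) (AG_par n F)"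
    using assms unfolding desarguesian_def by (elim exE conjE)
  obtain f where bij: "bij_betw f P (AG_points n F)" and lines: "(\<lambda>l. f ` l) ` L = AG_lines n F"
    and par: "\<forall>l\<in>L. \<forall>m\<in>L. par l m \<longleftrightarrow> AG_par n F (f ` l) (f ` m)"
    using iso unfolding affine_iso_def by (elim exE conjE)
  interpret F: field F by fact
  let ?A = "AG_points n F"
  have car: "z i \<in> carrier F" if "z \<in> ?A" for z i using AG_points_carrier[OF F.ring_axioms that] .
  have fA: "f p \<in> ?A" if "p \<in> P" for p using bij that by (auto simp: bij_betw_def)
  have finA: "finite ?A" using bij finite_P bij_betw_finite by blast
  have "\<exists>g\<in>dilatations. g x = u \<and> g y = v"
    if P: "x \<in> P" "y \<in> P" "x \<noteq> y" and uv: "u \<in> P" "v \<in> P" "u \<noteq> v" and d: "pdir u v = pdir x y" for x y u v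
  proof -
    have xyL: "ln x y \<in> L" and uvL: "ln u v \<in> L" using ln_line P uv by auto
    have "par (ln x y) (ln u v)" using pdir_eq_iff[OF P uv] d by simp
    then have "AG_par n F (f ` ln x y) (f ` ln u v)" using par xyL uvL by blast
    then obtain w where w: "w \<in> ?A" "f ` ln u v = (\<lambda>z i. z i \<oplus>\<^bsub>F\<^esub> w i) ` (f ` ln x y)"
      unfolding AG_par_def by blast
    have "f ` ln x y \<in> AG_lines n F" using lines xyL by blast
    then obtain a e where ae: "a \<in> ?A" "e \<in> ?A"
      and fl: "f ` ln x y = {(\<lambda>i. a i \<oplus>\<^bsub>F\<^esub> (t \<otimes>\<^bsub>F\<^esub> e i)) | t. t \<in> carrier F}"
      unfolding AG_lines_def by blast
    have pt: "\<exists>t\<in>carrier F. f p = (\<lambda>i. a i \<oplus>\<^bsub>F\<^esub> (t \<otimes>\<^bsub>F\<^esub> e i))" if "p \<in> ln x y" for p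
    proof -
      have "f p \<in> {(\<lambda>i. a i \<oplus>\<^bsub>F\<^esub> (t \<otimes>\<^bsub>F\<^esub> e i)) | t. t \<in> carrier F}" using that fl by blast
      then show ?thesis by blast
    qed
    obtain t1 where t1: "t1 \<in> carrier F" "f x = (\<lambda>i. a i \<oplus>\<^bsub>F\<^esub> (t1 \<otimes>\<^bsub>F\<^esub> e i))"
      using pt[OF ln_left[OF P]] by blast
    obtain t2 where t2: "t2 \<in> carrier F" "f y = (\<lambda>i. a i \<oplus>\<^bsub>F\<^esub> (t2 \<otimes>\<^bsub>F\<^esub> e i))"
      using pt[OF ln_right[OF P]] by blast
    have pt': "\<exists>t\<in>carrier F. f p = (\<lambda>i. a i \<oplus>\<^bsub>F\<^esub> (t \<otimes>\<^bsub>F\<^esub> e i) \<oplus>\<^bsub>F\<^esub> w i)" if "p \<in> ln u v" for p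
    proof -
      have "f p \<in> (\<lambda>z i. z i \<oplus>\<^bsub>F\<^esub> w i) ` {(\<lambda>i. a i \<oplus>\<^bsub>F\<^esub> (t \<otimes>\<^bsub>F\<^esub> e i)) | t. t \<in> carrier F}"
        using that w(2) unfolding fl by blast
      then show ?thesis by blast
    qed
    obtain t3 where t3: "t3 \<in> carrier F" "f u = (\<lambda>i. a i \<oplus>\<^bsub>F\<^esub> (t3 \<otimes>\<^bsub>F\<^esub> e i) \<oplus>\<^bsub>F\<^esub> w i)"
      using pt'[OF ln_left[OF uv]] by blast
    obtain t4 where t4: "t4 \<in> carrier F" "f v = (\<lambda>i. a i \<oplus>\<^bsub>F\<^esub> (t4 \<otimes>\<^bsub>F\<^esub> e i) \<oplus>\<^bsub>F\<^esub> w i)"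
      using pt'[OF ln_right[OF uv]] by blast
    have inj: "p = r" if "f p = f r" "p \<in> P" "r \<in> P" for p r
      using bij that by (auto simp: bij_betw_def dest: inj_onD)
    have "t1 \<noteq> t2" using inj[of x y] t1 t2 P by metis
    then have U12: "t2 \<ominus>\<^bsub>F\<^esub> t1 \<in> Units F" using F.r_right_minus_eq[OF t2(1) t1(1)] t1(1) t2(1) by (auto simp: F.field_Units)
    have "t3 \<noteq> t4" using inj[of u v] t3 t4 uv by metis
    then have U34: "t4 \<ominus>\<^bsub>F\<^esub> t3 \<in> Units F" using F.r_right_minus_eq[OF t4(1) t3(1)] t3(1) t4(1) by (auto simp: F.field_Units)
    \<comment> \<open>The ratio of the two parameter differences, chosen so that f v - f u is
      \<open>c\<close> times f y - f x.\<close>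
    define c where "c = (t4 \<ominus>\<^bsub>F\<^esub> t3) \<otimes>\<^bsub>F\<^esub> inv\<^bsub>F\<^esub> (t2 \<ominus>\<^bsub>F\<^esub> t1)"
    have cU: "c \<in> Units F" unfolding c_def using U12 U34 by blast
    have c: "c \<in> carrier F" and ic: "inv\<^bsub>F\<^esub> c \<in> carrier F" and icc: "inv\<^bsub>F\<^esub> c \<otimes>\<^bsub>F\<^esub> c = \<one>\<^bsub>F\<^esub>"
      using cU by (auto simp: F.Units_closed F.Units_inv_closed F.Units_l_inv)
    have ct: "c \<otimes>\<^bsub>F\<^esub> (t2 \<ominus>\<^bsub>F\<^esub> t1) = t4 \<ominus>\<^bsub>F\<^esub> t3"
      unfolding c_def using U12 t1 t2 t3 t4
      by (simp add: F.m_assoc F.Units_l_inv F.Units_inv_closed)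
    \<comment> \<open>Scaling by \<open>c\<close> combined with the shift that carries f x to f u;
      by the choice of \<open>c\<close> it carries f y to f v.\<close>
    define A where "A = (\<lambda>z i. c \<otimes>\<^bsub>F\<^esub> (z i \<ominus>\<^bsub>F\<^esub> f x i) \<oplus>\<^bsub>F\<^esub> f u i)"
    have AA: "A z \<in> ?A" if "z \<in> ?A" for z
      using that fA[OF P(1)] fA[OF uv(1)] c by (simp add: A_def AG_points_def F.minus_eq F.r_neg)
    have Ainj: "inj_on A ?A"
    proof (rule inj_onI, rule ext)
      fix z z' i assume z: "z \<in> ?A" "z' \<in> ?A" "A z = A z'"
      note cs = car[OF z(1), of i] car[OF z(2), of i] car[OF fA[OF P(1)], of i] car[OF fA[OF uv(1)], of i]
      have "c \<otimes>\<^bsub>F\<^esub> (z i \<ominus>\<^bsub>F\<^esub> f x i) \<oplus>\<^bsub>F\<^esub> f u i = c \<otimes>\<^bsub>F\<^esub> (z' i \<ominus>\<^bsub>F\<^esub> f x i) \<oplus>\<^bsub>F\<^esub> f u i"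
        using fun_cong[OF z(3), of i] by (simp add: A_def)
      then have "c \<otimes>\<^bsub>F\<^esub> (z i \<ominus>\<^bsub>F\<^esub> f x i) = c \<otimes>\<^bsub>F\<^esub> (z' i \<ominus>\<^bsub>F\<^esub> f x i)" using cs c by simp
      then have "z i \<ominus>\<^bsub>F\<^esub> f x i = z' i \<ominus>\<^bsub>F\<^esub> f x i" using cs cU F.Units_l_cancel[OF cU] by simp
      then show "z i = z' i" using cs by (simp add: F.minus_eq)
    qed
    have Aimg: "A ` ?A = ?A" using endo_inj_surj[OF finA _ Ainj] AA by blast
    let ?inv = "inv_into P f"
    define g where "g = (\<lambda>p. if p \<in> P then ?inv (A (f p)) else p)"
    have fg: "f (g p) = A (f p)" and gP: "g p \<in> P" if "p \<in> P" for p
      using that AA[OF fA[OF that]] bij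
      by (auto simp: g_def bij_betw_def f_inv_into_f inv_into_into)
    have invf: "?inv (f p) = p" if "p \<in> P" for p using bij that by (simp add: bij_betw_def)
    have "bij_betw g P P"
    proof -
      have "bij_betw A ?A ?A" using Ainj Aimg by (simp add: bij_betw_def)
      then have "bij_betw (?inv \<circ> (A \<circ> f)) P P"
        by (rule bij_betw_trans[OF bij_betw_trans[OF bij] bij_betw_inv_into[OF bij]])
      then show ?thesis by (rule bij_betw_cong[THEN iffD1, rotated]) (simp add: g_def)
    qed
    then have gperm: "g permutes P" by (rule bij_imp_permutes) (simp add: g_def)
    \<comment> \<open>\<open>A\<close> multiplies direction vectors by the unit \<open>c\<close>,
      which only reparametrises a line, so the image of \<open>k\<close> is parallel to
      \<open>k\<close>.\<close>
    have Aline: "A ` k \<in> AG_lines n F \<and> AG_par n F k (A ` k)" if k: "k \<in> AG_lines n F" for k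
    proof -
      obtain b h where bh: "b \<in> ?A" "h \<in> ?A" "h \<noteq> (\<lambda>i. \<zero>\<^bsub>F\<^esub>)"
        and keq: "k = {(\<lambda>i. b i \<oplus>\<^bsub>F\<^esub> (t \<otimes>\<^bsub>F\<^esub> h i)) | t. t \<in> carrier F}"
        using k unfolding AG_lines_def by blast
      have Ab: "A b \<in> ?A" using AA bh by blast
      have A_pt: "A (\<lambda>i. b i \<oplus>\<^bsub>F\<^esub> (t \<otimes>\<^bsub>F\<^esub> h i)) = (\<lambda>i. A b i \<oplus>\<^bsub>F\<^esub> ((t \<otimes>\<^bsub>F\<^esub> c) \<otimes>\<^bsub>F\<^esub> h i))"
        if t: "t \<in> carrier F" for t
      proof
        fix i
        note cs = car[OF bh(1), of i] car[OF bh(2), of i] car[OF fA[OF P(1)], of i] car[OF fA[OF uv(1)], of i]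
        show "A (\<lambda>i. b i \<oplus>\<^bsub>F\<^esub> (t \<otimes>\<^bsub>F\<^esub> h i)) i = A b i \<oplus>\<^bsub>F\<^esub> ((t \<otimes>\<^bsub>F\<^esub> c) \<otimes>\<^bsub>F\<^esub> h i)"
          unfolding A_def using cs c t
          by (simp add: F.minus_eq F.r_distr F.l_distr F.m_ac F.a_ac)
      qed
      have Ak: "A ` k = {(\<lambda>i. A b i \<oplus>\<^bsub>F\<^esub> (t \<otimes>\<^bsub>F\<^esub> h i)) | t. t \<in> carrier F}"
      proof (intro equalityI subsetI)
        fix z assume "z \<in> A ` k"
        then obtain t where "t \<in> carrier F" "z = A (\<lambda>i. b i \<oplus>\<^bsub>F\<^esub> (t \<otimes>\<^bsub>F\<^esub> h i))" unfolding keq by blast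
        then show "z \<in> {(\<lambda>i. A b i \<oplus>\<^bsub>F\<^esub> (t \<otimes>\<^bsub>F\<^esub> h i)) | t. t \<in> carrier F}"
          using A_pt[of t] c by blast
      next
        fix z assume "z \<in> {(\<lambda>i. A b i \<oplus>\<^bsub>F\<^esub> (t \<otimes>\<^bsub>F\<^esub> h i)) | t. t \<in> carrier F}"
        then obtain t where t: "t \<in> carrier F" "z = (\<lambda>i. A b i \<oplus>\<^bsub>F\<^esub> (t \<otimes>\<^bsub>F\<^esub> h i))" by blast
        have s: "t \<otimes>\<^bsub>F\<^esub> inv\<^bsub>F\<^esub> c \<in> carrier F" "(t \<otimes>\<^bsub>F\<^esub> inv\<^bsub>F\<^esub> c) \<otimes>\<^bsub>F\<^esub> c = t"
          using t(1) c ic icc by (simp_all add: F.m_assoc)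
        then have "z = A (\<lambda>i. b i \<oplus>\<^bsub>F\<^esub> ((t \<otimes>\<^bsub>F\<^esub> inv\<^bsub>F\<^esub> c) \<otimes>\<^bsub>F\<^esub> h i))"
          using A_pt[OF s(1)] t(2) by simp
        then show "z \<in> A ` k" unfolding keq using s(1) by blast
      qed
      have AkL: "A ` k \<in> AG_lines n F" unfolding Ak AG_lines_def using Ab bh by blast
      \<comment> \<open>\<open>s\<close> moves the base point b to A b and therefore translates
        \<open>k\<close> onto its image, as \<open>AG_par\<close> requires.\<close>
      define s where "s = (\<lambda>i. A b i \<ominus>\<^bsub>F\<^esub> b i)"
      have sA: "s \<in> ?A" using Ab bh(1) by (simp add: s_def AG_points_def F.minus_eq F.r_neg)
      have shift: "(\<lambda>i. (b i \<oplus>\<^bsub>F\<^esub> (t \<otimes>\<^bsub>F\<^esub> h i)) \<oplus>\<^bsub>F\<^esub> s i) = (\<lambda>i. A b i \<oplus>\<^bsub>F\<^esub> (t \<otimes>\<^bsub>F\<^esub> h i))"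
        if t: "t \<in> carrier F" for t
      proof
        fix i
        note cs = car[OF bh(1), of i] car[OF bh(2), of i] car[OF Ab, of i]
        have "(b i \<oplus>\<^bsub>F\<^esub> (t \<otimes>\<^bsub>F\<^esub> h i)) \<oplus>\<^bsub>F\<^esub> (A b i \<ominus>\<^bsub>F\<^esub> b i)
          = (A b i \<oplus>\<^bsub>F\<^esub> (t \<otimes>\<^bsub>F\<^esub> h i)) \<oplus>\<^bsub>F\<^esub> (b i \<ominus>\<^bsub>F\<^esub> b i)"
          using cs t by (simp add: F.minus_eq F.a_ac)
        then show "(b i \<oplus>\<^bsub>F\<^esub> (t \<otimes>\<^bsub>F\<^esub> h i)) \<oplus>\<^bsub>F\<^esub> s i = A b i \<oplus>\<^bsub>F\<^esub> (t \<otimes>\<^bsub>F\<^esub> h i)"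
          using cs t by (simp add: s_def F.minus_eq F.r_neg)
      qed
      have "(\<lambda>z i. z i \<oplus>\<^bsub>F\<^esub> s i) ` k = (\<lambda>t i. (b i \<oplus>\<^bsub>F\<^esub> (t \<otimes>\<^bsub>F\<^esub> h i)) \<oplus>\<^bsub>F\<^esub> s i) ` carrier F"
        unfolding keq Setcompr_eq_image image_image ..
      also have "\<dots> = (\<lambda>t i. A b i \<oplus>\<^bsub>F\<^esub> (t \<otimes>\<^bsub>F\<^esub> h i)) ` carrier F"
        by (rule image_cong[OF refl shift])
      finally have "A ` k = (\<lambda>z i. z i \<oplus>\<^bsub>F\<^esub> s i) ` k" unfolding Ak Setcompr_eq_image ..
      then show ?thesis using AkL k sA unfolding AG_par_def by blast
    qed
    have "g \<in> dilatations" unfolding dilatations_def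
    proof (intro CollectI conjI ballI impI gperm)
      fix p r assume pr: "p \<in> P" "r \<in> P" "p \<noteq> r"
      have pL: "ln p r \<in> L" using ln_line[OF pr] .
      then have k: "f ` ln p r \<in> AG_lines n F" using lines by blast
      \<comment> \<open>The image of a line under \<open>A\<close> is again the image under
        \<open>f\<close> of a line \<open>m\<close>. This \<open>m\<close> is parallel to pr and
        contains g p and g r, so it is their join.\<close>
      have "A ` (f ` ln p r) \<in> (\<lambda>l. f ` l) ` L" unfolding lines using Aline[OF k] by (rule conjunct1)
      then obtain m where fm: "A ` (f ` ln p r) = f ` m" and mL: "m \<in> L" by (rule imageE)
      note m = mL fm[symmetric]
      have "AG_par n F (f ` ln p r) (f ` m)" unfolding m(2) using Aline[OF k] by (rule conjunct2)
      then have "par (ln p r) m" using par pL mL by blast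
      have gm: "g q \<in> m" if "q \<in> ln p r" for q
      proof -
        have qP: "q \<in> P" using that line_subset[OF pL] by blast
        have "f (g q) \<in> f ` m" using fg[OF qP] that m(2) by blast
        then obtain q' where "q' \<in> m" "f (g q) = f q'" by blast
        then show ?thesis using inj[of "g q" q'] gP[OF qP] line_subset[OF m(1)] by blast
      qed
      have neq: "g p \<noteq> g r" using permutes_inj[OF gperm] pr by (auto dest: injD)
      have "ln (g p) (g r) = m" using ln_eqI[OF m(1) gm[OF ln_left[OF pr]] gm[OF ln_right[OF pr]] neq] .
      then show "pdir (g p) (g r) = pdir p r"
        using pdir_eq_iff[OF gP[OF pr(1)] gP[OF pr(2)] neq pr] par_sym[OF \<open>par (ln p r) m\<close>] by simp
    qed
    moreover have "g x = u"
    proof -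
      have "A (f x) = f u"
        using car[OF fA[OF P(1)]] car[OF fA[OF uv(1)]] c by (simp add: A_def F.minus_eq F.r_neg fun_eq_iff)
      then show ?thesis using invf[OF uv(1)] P by (simp add: g_def)
    qed
    moreover have "g y = v"
    proof -
      have "A (f y) = f v"
      proof
        fix i
        note cs = car[OF ae(1), of i] car[OF ae(2), of i] car[OF w(1), of i] t1(1) t2(1) t3(1) t4(1) c
        have "f y i \<ominus>\<^bsub>F\<^esub> f x i = (t2 \<ominus>\<^bsub>F\<^esub> t1) \<otimes>\<^bsub>F\<^esub> e i"
          unfolding t1(2) t2(2) using cs by algebra
        then have "A (f y) i = (c \<otimes>\<^bsub>F\<^esub> (t2 \<ominus>\<^bsub>F\<^esub> t1)) \<otimes>\<^bsub>F\<^esub> e i \<oplus>\<^bsub>F\<^esub> f u i"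
          unfolding A_def using cs by (simp add: F.m_assoc)
        also have "\<dots> = f v i" unfolding ct t3(2) t4(2) using cs by algebra
        finally show "A (f y) i = f v i" .
      qed
      then show ?thesis using invf[OF uv(2)] P by (simp add: g_def)
    qed
    ultimately show ?thesis by blast
  qed
  then have "\<forall>x\<in>P. \<forall>y\<in>P. x \<noteq> y \<longrightarrow> pair_orbit dilatations (x, y) = dir_class x y"
    using orbit_dilatations by blast
  then have "affine_scheme P L par = pair_orbit dilatations ` (P \<times> P)"
    using scheme_eq_orbits_iff[OF perm_group_dilatations] by blast
  then show ?thesis unfolding schurian_def using perm_group_dilatations by blast
qed

end

theorem theorem3p1:
  fixes P :: "'a set" and L :: "'a set set" and par :: "'a set \<Rightarrow> 'a set \<Rightarrow> bool"
  assumes "finite_affine_space P L par"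
  shows "schurian P (affine_scheme P L par) \<longleftrightarrow> desarguesian P L par"
proof -
  interpret affine_space P L par using assms by (rule affine_space.intro)
  show ?thesis using schurian_imp_desarguesian desarguesian_imp_schurian by blast
qed

end
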